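(* The functors $Q:\mathbf{LO}_*\to\mathbf{Circ}$ and $L:\mathbf{Circ}\to\mathbf{LO}_*$ provide an equivalence of categories $\mathbf{LO}_*\cong\mathbf{Circ}$ (that is, $LQ$ and $QL$ are naturally isomorphic to the identity functors of $\mathbf{LO}_*$ and $\mathbf{Circ}$ respectively).
   Context: A left ordering of a group $G$ is a strict total ordering $<$ with $g<h\Rightarrow fg<fh$; it is determined by its positive cone $P=\{g: g>id\}$ via $g<h\iff g^{-1}h\in P$. An element $z\in G$ is cofinal for $<$ if for every $g\in G$ there is $k\in\mathbb{Z}$ with $z^{-k}<g<z^k$. A circular ordering of a group $G$ is a function $c:G^3\to\{0,\pm1\}$ such that: $c(a_1,a_2,a_3)=0$ iff $a_i=a_j$ for some $i\ne j$; $c(a_2,a_3,a_4)-c(a_1,a_3,a_4)+c(a_1,a_2,a_4)-c(a_1,a_2,a_3)=0$ for all $a_1,\dots,a_4$; and $c(ga_1,ga_2,ga_3)=c(a_1,a_2,a_3)$ for all $g,a_1,a_2,a_3\in G$. Category $\mathbf{Circ}$: objects are circularly-ordered groups $(G,c)$; morphisms $\phi:(G,c)\to(H,d)$ are homomorphisms with $c(g_1,g_2,g_3)=d(\phi(g_1),\phi(g_2),\phi(g_3))$ for all $g_1,g_2,g_3\in G$. Category $\mathbf{LO}_*$: objects are triples $(G,<,z)$ where $<$ is a left ordering of $G$ and $z\in G$ is central, positive ($z>id$) and cofinal; morphisms $\phi:(G,<,z)\to(H,\prec,w)$ are homomorphisms with $g_1<g_2\iff\phi(g_1)\prec\phi(g_2)$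 for all $g_1,g_2$ and $\phi(z)=w$. Functor $L$: on objects $L(G,c)=(\widetilde G,<_c,z_c)$, where $\widetilde G$ is the set $\mathbb{Z}\times G$ with multiplication $(n,a)(m,b)=(n+m+f_c(a,b),ab)$, with $f_c(a,b)=0$ if $a=id$ or $b=id$ or $c(id,a,ab)=1$, and $f_c(a,b)=1$ if $ab=id$ with $a\ne id$, or $c(id,ab,a)=1$; $<_c$ has positive cone $\{(n,a):n\ge0\}\setminus\{(0,id)\}$; and $z_c=(1,id)$. On morphisms $L(\phi)(n,a)=(n,\phi(a))$. Functor $Q$: on objects $Q(G,<,z)=(G/\langle z\rangle,c_<)$. Each coset $g\langle z\rangle$ has a unique minimal representative $\overline g\in g\langle z\rangle$ with $id\le\overline g<z$; on triples of distinct cosets $c_<(g_1\langle z\rangle,g_2\langle z\rangle,g_3\langle z\rangle)=\mathrm{sign}(\sigma)$, where $\sigma\in S_3$ is the unique permutation with $\overline{g_{\sigma(1)}}<\overline{g_{\sigma(2)}}<\overline{g_{\sigma(3)}}$, and $c_<=0$ on other triples. On a morphism $\theta:(G,<,z)\to(H,\prec,w)$, $Q(\theta)(g\langle z\rangle)=\theta(g)\langle w\rangle$.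
   Formalization: Morphisms of Circ are also required to be injective; this excludes only trivial homomorphisms from groups of order 2, which preserve c (it vanishes on Z/2) but on which L(φ) is not a homomorphism, so that L would not be a functor. *)

theory Defs
  imports
    "HOL-Algebra.Coset"
    "HOL-Algebra.Generated_Groups"
    "HOL-Combinatorics.Permutations"
    "HOL-Library.Countable_Set_Type"
    "HOL-Library.FuncSet"
begin

section \<open>Categories, functors, natural isomorphisms\<close>

text \<open>
  Hom-sets are indexed by their source and target and need not be disjoint; accordingly identities,
  composition and the action of a functor on morphisms take the objects involved as arguments.
  \<open>Comp C X Y Z g f\<close> is the composite of \<open>f : X \<rightarrow> Y\<close> and \<open>g : Y \<rightarrow> Z\<close>.
\<close>

record ('o, 'm) cat =
  Obj :: "'o set"
  Hom :: "'o \<Rightarrow> 'o \<Rightarrow> 'm set"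
  Ident :: "'o \<Rightarrow> 'm"
  Comp :: "'o \<Rightarrow> 'o \<Rightarrow> 'o \<Rightarrow> 'm \<Rightarrow> 'm \<Rightarrow> 'm"

definition is_category :: "('o, 'm) cat \<Rightarrow> bool" where
  "is_category C \<longleftrightarrow>
     (\<forall>X\<in>Obj C. Ident C X \<in> Hom C X X) \<and>
     (\<forall>X\<in>Obj C. \<forall>Y\<in>Obj C. \<forall>Z\<in>Obj C. \<forall>f\<in>Hom C X Y. \<forall>g\<in>Hom C Y Z.
        Comp C X Y Z g f \<in> Hom C X Z) \<and>
     (\<forall>X\<in>Obj C. \<forall>Y\<in>Obj C. \<forall>f\<in>Hom C X Y.
        Comp C X X Y f (Ident C X) = f \<and> Comp C X Y Y (Ident C Y) f = f) \<and>
     (\<forall>W\<in>Obj C. \<forall>X\<in>Obj C. \<forall>Y\<in>Obj C. \<forall>Z\<in>Obj C.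
        \<forall>f\<in>Hom C W X. \<forall>g\<in>Hom C X Y. \<forall>h\<in>Hom C Y Z.
        Comp C W Y Z h (Comp C W X Y g f) = Comp C W X Z (Comp C X Y Z h g) f)"

definition is_isomorphism :: "('o, 'm) cat \<Rightarrow> 'o \<Rightarrow> 'o \<Rightarrow> 'm \<Rightarrow> bool" where
  "is_isomorphism C X Y f \<longleftrightarrow> f \<in> Hom C X Y \<and>
     (\<exists>g\<in>Hom C Y X. Comp C X Y X g f = Ident C X \<and> Comp C Y X Y f g = Ident C Y)"

record ('o, 'm, 'p, 'n) fctr =
  on_obj :: "'o \<Rightarrow> 'p"
  on_hom :: "'o \<Rightarrow> 'o \<Rightarrow> 'm \<Rightarrow> 'n"

definition is_functor :: "('o, 'm) cat \<Rightarrow> ('p, 'n) cat \<Rightarrow> ('o, 'm, 'p, 'n) fctr \<Rightarrow> bool" where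
  "is_functor C D F \<longleftrightarrow>
     (\<forall>X\<in>Obj C. on_obj F X \<in> Obj D) \<and>
     (\<forall>X\<in>Obj C. \<forall>Y\<in>Obj C. \<forall>f\<in>Hom C X Y.
        on_hom F X Y f \<in> Hom D (on_obj F X) (on_obj F Y)) \<and>
     (\<forall>X\<in>Obj C. on_hom F X X (Ident C X) = Ident D (on_obj F X)) \<and>
     (\<forall>X\<in>Obj C. \<forall>Y\<in>Obj C. \<forall>Z\<in>Obj C. \<forall>f\<in>Hom C X Y. \<forall>g\<in>Hom C Y Z.
        on_hom F X Z (Comp C X Y Z g f) =
        Comp D (on_obj F X) (on_obj F Y) (on_obj F Z) (on_hom F Y Z g) (on_hom F X Y f))"

definition id_functor :: "('o, 'm, 'o, 'm) fctr" where
  "id_functor = \<lparr>on_obj = (\<lambda>X. X), on_hom = (\<lambda>X Y f. f)\<rparr>"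

definition comp_functor ::
  "('p, 'n, 'q, 'l) fctr \<Rightarrow> ('o, 'm, 'p, 'n) fctr \<Rightarrow> ('o, 'm, 'q, 'l) fctr" where
  "comp_functor G F =
     \<lparr>on_obj = (\<lambda>X. on_obj G (on_obj F X)),
      on_hom = (\<lambda>X Y f. on_hom G (on_obj F X) (on_obj F Y) (on_hom F X Y f))\<rparr>"

definition natural_transformation ::
  "('o, 'm) cat \<Rightarrow> ('p, 'n) cat \<Rightarrow> ('o, 'm, 'p, 'n) fctr \<Rightarrow> ('o, 'm, 'p, 'n) fctr
     \<Rightarrow> ('o \<Rightarrow> 'n) \<Rightarrow> bool" where
  "natural_transformation C D F G \<eta> \<longleftrightarrow>
     (\<forall>X\<in>Obj C. \<eta> X \<in> Hom D (on_obj F X) (on_obj G X)) \<and>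
     (\<forall>X\<in>Obj C. \<forall>Y\<in>Obj C. \<forall>f\<in>Hom C X Y.
        Comp D (on_obj F X) (on_obj F Y) (on_obj G Y) (\<eta> Y) (on_hom F X Y f) =
        Comp D (on_obj F X) (on_obj G X) (on_obj G Y) (on_hom G X Y f) (\<eta> X))"

definition naturally_isomorphic ::
  "('o, 'm) cat \<Rightarrow> ('p, 'n) cat \<Rightarrow> ('o, 'm, 'p, 'n) fctr \<Rightarrow> ('o, 'm, 'p, 'n) fctr \<Rightarrow> bool" where
  "naturally_isomorphic C D F G \<longleftrightarrow>
     (\<exists>\<eta>. natural_transformation C D F G \<eta> \<and>
          (\<forall>X\<in>Obj C. is_isomorphism D (on_obj F X) (on_obj G X) (\<eta> X)))"

definition equivalence_of_categories ::
  "('o, 'm) cat \<Rightarrow> ('p, 'n) cat \<Rightarrow> ('o, 'm, 'p, 'n) fctr \<Rightarrow> ('p, 'n, 'o, 'm) fctr \<Rightarrow> bool" where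
  "equivalence_of_categories C D F G \<longleftrightarrow>
     is_category C \<and> is_category D \<and> is_functor C D F \<and> is_functor D C G \<and>
     naturally_isomorphic C C (comp_functor G F) id_functor \<and>
     naturally_isomorphic D D (comp_functor F G) id_functor"


section \<open>Ordered groups\<close>

record 'a circ_group = "'a monoid" +
  corder :: "'a \<Rightarrow> 'a \<Rightarrow> 'a \<Rightarrow> int"

record 'a lo_group = "'a monoid" +
  lless :: "'a \<Rightarrow> 'a \<Rightarrow> bool"
  zelt :: 'a

definition circular_ordering ::
  "('a, 'b) monoid_scheme \<Rightarrow> ('a \<Rightarrow> 'a \<Rightarrow> 'a \<Rightarrow> int) \<Rightarrow> bool" where
  "circular_ordering G c \<longleftrightarrow>
     (\<forall>a1\<in>carrier G. \<forall>a2\<in>carrier G. \<forall>a3\<in>carrier G. c a1 a2 a3 \<in> {0, 1, -1}) \<and>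
     (\<forall>a1\<in>carrier G. \<forall>a2\<in>carrier G. \<forall>a3\<in>carrier G.
        c a1 a2 a3 = 0 \<longleftrightarrow> a1 = a2 \<or> a1 = a3 \<or> a2 = a3) \<and>
     (\<forall>a1\<in>carrier G. \<forall>a2\<in>carrier G. \<forall>a3\<in>carrier G. \<forall>a4\<in>carrier G.
        c a2 a3 a4 - c a1 a3 a4 + c a1 a2 a4 - c a1 a2 a3 = 0) \<and>
     (\<forall>g\<in>carrier G. \<forall>a1\<in>carrier G. \<forall>a2\<in>carrier G. \<forall>a3\<in>carrier G.
        c (g \<otimes>\<^bsub>G\<^esub> a1) (g \<otimes>\<^bsub>G\<^esub> a2) (g \<otimes>\<^bsub>G\<^esub> a3) = c a1 a2 a3)"

definition left_ordering :: "('a, 'b) monoid_scheme \<Rightarrow> ('a \<Rightarrow> 'a \<Rightarrow> bool) \<Rightarrow> bool" where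
  "left_ordering G lt \<longleftrightarrow>
     irreflp_on (carrier G) lt \<and> transp_on (carrier G) lt \<and> totalp_on (carrier G) lt \<and>
     (\<forall>f\<in>carrier G. \<forall>g\<in>carrier G. \<forall>h\<in>carrier G.
        lt g h \<longrightarrow> lt (f \<otimes>\<^bsub>G\<^esub> g) (f \<otimes>\<^bsub>G\<^esub> h))"

definition less_of_cone :: "('a, 'b) monoid_scheme \<Rightarrow> 'a set \<Rightarrow> 'a \<Rightarrow> 'a \<Rightarrow> bool" where
  "less_of_cone G P g h \<longleftrightarrow> inv\<^bsub>G\<^esub> g \<otimes>\<^bsub>G\<^esub> h \<in> P"

definition cofinal :: "('a, 'b) monoid_scheme \<Rightarrow> ('a \<Rightarrow> 'a \<Rightarrow> bool) \<Rightarrow> 'a \<Rightarrow> bool" where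
  "cofinal G lt z \<longleftrightarrow>
     (\<forall>g\<in>carrier G. \<exists>k::int. lt (z [^]\<^bsub>G\<^esub> (- k)) g \<and> lt g (z [^]\<^bsub>G\<^esub> k))"

definition central :: "('a, 'b) monoid_scheme \<Rightarrow> 'a \<Rightarrow> bool" where
  "central G z \<longleftrightarrow> (\<forall>g\<in>carrier G. z \<otimes>\<^bsub>G\<^esub> g = g \<otimes>\<^bsub>G\<^esub> z)"


section \<open>The two categories\<close>

text \<open>
  Morphisms are extensional functions (constantly \<^const>\<open>undefined\<close> off the source carrier), so that
  equality of morphisms is equality of functions on the carrier.

  Morphisms of circularly ordered groups are required to be injective. This follows from
  preservation of the circular orderings unless the source has exactly two elements (see
  \<open>corder_preserving_inj\<close> below). On the group of order two the circular ordering vanishes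
  identically, so that its trivial homomorphism to any \<open>H\<close> also preserves the orderings. That map
  has to be excluded: for \<open>a \<noteq> id\<close> one has \<open>(0, a) (0, a) = (1, id)\<close> in the lift, but
  \<open>(n, x) \<mapsto> (n, id)\<close> sends the left side to \<open>(0, id)\<close> and the right side to \<open>(1, id)\<close>, so the
  lift would not be defined on it.
\<close>

definition circ_hom :: "'a circ_group \<Rightarrow> 'b circ_group \<Rightarrow> ('a \<Rightarrow> 'b) set" where
  "circ_hom G H =
     {\<phi> \<in> hom G H. \<phi> \<in> extensional (carrier G) \<and> inj_on \<phi> (carrier G) \<and>
        (\<forall>g1\<in>carrier G. \<forall>g2\<in>carrier G. \<forall>g3\<in>carrier G.
           corder G g1 g2 g3 = corder H (\<phi> g1) (\<phi> g2) (\<phi> g3))}"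

definition Circ :: "('a circ_group, 'a \<Rightarrow> 'a) cat" where
  "Circ =
     \<lparr>Obj = {G. group G \<and> circular_ordering G (corder G)},
      Hom = circ_hom,
      Ident = (\<lambda>G. \<lambda>x\<in>carrier G. x),
      Comp = (\<lambda>G H K \<psi> \<phi>. compose (carrier G) \<psi> \<phi>)\<rparr>"

definition lo_hom :: "'a lo_group \<Rightarrow> 'b lo_group \<Rightarrow> ('a \<Rightarrow> 'b) set" where
  "lo_hom G H =
     {\<phi> \<in> hom G H. \<phi> \<in> extensional (carrier G) \<and>
        (\<forall>g1\<in>carrier G. \<forall>g2\<in>carrier G. lless G g1 g2 \<longleftrightarrow> lless H (\<phi> g1) (\<phi> g2)) \<and>
        \<phi> (zelt G) = zelt H}"

definition LO_star :: "('a lo_group, 'a \<Rightarrow> 'a) cat" where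
  "LO_star =
     \<lparr>Obj = {G. group G \<and> left_ordering G (lless G) \<and> zelt G \<in> carrier G \<and>
                central G (zelt G) \<and> lless G \<one>\<^bsub>G\<^esub> (zelt G) \<and> cofinal G (lless G) (zelt G)},
      Hom = lo_hom,
      Ident = (\<lambda>G. \<lambda>x\<in>carrier G. x),
      Comp = (\<lambda>G H K \<psi> \<phi>. compose (carrier G) \<psi> \<phi>)\<rparr>"

lemma corder_preserving_inj:
  assumes c: "circular_ordering G (corder G)" and d: "circular_ordering H (corder H)"
    and \<phi>: "\<phi> \<in> hom G H"
    and pres: "\<And>g1 g2 g3. \<lbrakk>g1 \<in> carrier G; g2 \<in> carrier G; g3 \<in> carrier G\<rbrakk>
                 \<Longrightarrow> corder G g1 g2 g3 = corder H (\<phi> g1) (\<phi> g2) (\<phi> g3)"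
    and two: "card (carrier G) \<noteq> 2"
  shows "inj_on \<phi> (carrier G)"
proof (rule inj_onI)
  fix x y assume x: "x \<in> carrier G" and y: "y \<in> carrier G" and eq: "\<phi> x = \<phi> y"
  have im: "\<phi> u \<in> carrier H" if "u \<in> carrier G" for u
    using \<phi> that by (auto simp: hom_def)
  show "x = y"
  proof (rule ccontr)
    assume ne: "x \<noteq> y"
    then have "card {x, y} = 2" by simp
    then have "carrier G \<noteq> {x, y}" using two by auto
    then obtain w where w: "w \<in> carrier G" "w \<noteq> x" "w \<noteq> y" using x y by blast
    have "corder H (\<phi> x) (\<phi> y) (\<phi> w) = 0"
      using d im[OF x] im[OF y] im[OF w(1)] eq by (simp add: circular_ordering_def)
    then have "corder G x y w = 0" using pres[OF x y w(1)] by simp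
    then show False using c x y w ne by (auto simp: circular_ordering_def)
  qed
qed


section \<open>A universe closed under the two constructions\<close>

text \<open>
  The underlying set of the lift of \<open>G\<close> is \<open>\<int> \<times> G\<close>, and that of the quotient of \<open>G\<close> consists of
  cosets of a cyclic, hence countable, subgroup. For \<open>L\<close> and \<open>Q\<close> to be functors between two fixed
  categories, underlying sets are taken inside a type that is freely closed under pairs with an
  integer and under countable subsets, over an arbitrary type \<open>'a\<close> of atoms. Every group whose
  carrier lies in \<open>'a\<close> has a copy in \<open>'a universe\<close>, along \<open>Atom\<close>.
\<close>

datatype 'a universe =
    Atom 'a
  | Lift (lift_int: int) (lift_elt: "'a universe")
  | Coset (coset_members: "'a universe cset")

text \<open>\<open>encode_set\<close> is injective on countable sets, with left inverse \<open>decode_set\<close>.\<close>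

definition encode_set :: "'a universe set \<Rightarrow> 'a universe" where
  "encode_set X = Coset (acset X)"

definition decode_set :: "'a universe \<Rightarrow> 'a universe set" where
  "decode_set x = rcset (coset_members x)"

lemma decode_encode_set: "countable X \<Longrightarrow> decode_set (encode_set X) = X"
  by (simp add: encode_set_def decode_set_def acset_inverse)


section \<open>The functor \<open>L\<close>\<close>

text \<open>For a circular ordering the two conditions below are exclusive and exhaustive.\<close>

definition lift_cocycle :: "'a circ_group \<Rightarrow> 'a \<Rightarrow> 'a \<Rightarrow> int" where
  "lift_cocycle G a b =
     (if a = \<one>\<^bsub>G\<^esub> \<or> b = \<one>\<^bsub>G\<^esub> \<or> corder G \<one>\<^bsub>G\<^esub> a (a \<otimes>\<^bsub>G\<^esub> b) = 1 then 0
      else if (a \<otimes>\<^bsub>G\<^esub> b = \<one>\<^bsub>G\<^esub> \<and> a \<noteq> \<one>\<^bsub>G\<^esub>) \<or> corder G \<one>\<^bsub>G\<^esub> (a \<otimes>\<^bsub>G\<^esub> b) a = 1 then 1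
      else undefined)"

definition lift_group :: "'a universe circ_group \<Rightarrow> 'a universe monoid" where
  "lift_group G =
     \<lparr>carrier = {Lift n a | n a. a \<in> carrier G},
      monoid.mult = (\<lambda>x y. Lift (lift_int x + lift_int y + lift_cocycle G (lift_elt x) (lift_elt y))
                         (lift_elt x \<otimes>\<^bsub>G\<^esub> lift_elt y)),
      one = Lift 0 \<one>\<^bsub>G\<^esub>\<rparr>"

definition lift_cone :: "'a universe circ_group \<Rightarrow> 'a universe set" where
  "lift_cone G = {Lift n a | n a. a \<in> carrier G \<and> n \<ge> 0} - {Lift 0 \<one>\<^bsub>G\<^esub>}"

definition L_obj :: "'a universe circ_group \<Rightarrow> 'a universe lo_group" where
  "L_obj G =
     \<lparr>carrier = carrier (lift_group G),
      monoid.mult = monoid.mult (lift_group G),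
      one = monoid.one (lift_group G),
      lless = less_of_cone (lift_group G) (lift_cone G),
      zelt = Lift 1 \<one>\<^bsub>G\<^esub>\<rparr>"

definition L_hom ::
  "'a universe circ_group \<Rightarrow> 'a universe circ_group
     \<Rightarrow> ('a universe \<Rightarrow> 'a universe) \<Rightarrow> 'a universe \<Rightarrow> 'a universe" where
  "L_hom G H \<phi> = (\<lambda>x\<in>carrier (L_obj G). Lift (lift_int x) (\<phi> (lift_elt x)))"

definition L_functor ::
  "('a universe circ_group, 'a universe \<Rightarrow> 'a universe,
    'a universe lo_group, 'a universe \<Rightarrow> 'a universe) fctr" where
  "L_functor = \<lparr>on_obj = L_obj, on_hom = L_hom\<rparr>"


section \<open>The functor \<open>Q\<close>\<close>

abbreviation zsub :: "'a lo_group \<Rightarrow> 'a set" where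
  "zsub G \<equiv> generate G {zelt G}"

definition min_rep :: "'a lo_group \<Rightarrow> 'a set \<Rightarrow> 'a" where
  "min_rep G X =
     (THE h. h \<in> X \<and> (\<one>\<^bsub>G\<^esub> = h \<or> lless G \<one>\<^bsub>G\<^esub> h) \<and> lless G h (zelt G))"

definition quotient_corder :: "'a lo_group \<Rightarrow> 'a set \<Rightarrow> 'a set \<Rightarrow> 'a set \<Rightarrow> int" where
  "quotient_corder G X1 X2 X3 =
     (if X1 \<noteq> X2 \<and> X1 \<noteq> X3 \<and> X2 \<noteq> X3 then
        (let r = (\<lambda>i::nat. min_rep G (if i = 1 then X1 else if i = 2 then X2 else X3)) in
         sign (THE \<sigma>. \<sigma> permutes {1, 2, 3} \<and>
                 lless G (r (\<sigma> 1)) (r (\<sigma> 2)) \<and> lless G (r (\<sigma> 2)) (r (\<sigma> 3))))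
      else 0)"

text \<open>
  The library's quotient group \<open>G Mod zsub G\<close> consists of right cosets; as \<^const>\<open>zelt\<close> is central
  in the objects of \<^const>\<open>LO_star\<close>, these are the left cosets as well.
\<close>

definition Q_obj :: "'a universe lo_group \<Rightarrow> 'a universe circ_group" where
  "Q_obj G =
     \<lparr>carrier = encode_set ` carrier (G Mod zsub G),
      monoid.mult = (\<lambda>x y. encode_set (decode_set x \<otimes>\<^bsub>G Mod zsub G\<^esub> decode_set y)),
      one = encode_set \<one>\<^bsub>G Mod zsub G\<^esub>,
      corder = (\<lambda>x y w. quotient_corder G (decode_set x) (decode_set y) (decode_set w))\<rparr>"

text \<open>The description determines a unique \<open>y\<close> because a morphism maps \<open>zsub G\<close> into \<open>zsub H\<close>.\<close>

definition Q_hom ::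
  "'a universe lo_group \<Rightarrow> 'a universe lo_group
     \<Rightarrow> ('a universe \<Rightarrow> 'a universe) \<Rightarrow> 'a universe \<Rightarrow> 'a universe" where
  "Q_hom G H \<theta> =
     (\<lambda>x\<in>carrier (Q_obj G).
        THE y. \<exists>g\<in>carrier G. x = encode_set (zsub G #>\<^bsub>G\<^esub> g) \<and>
                             y = encode_set (zsub H #>\<^bsub>H\<^esub> \<theta> g))"

definition Q_functor ::
  "('a universe lo_group, 'a universe \<Rightarrow> 'a universe,
    'a universe circ_group, 'a universe \<Rightarrow> 'a universe) fctr" where
  "Q_functor = \<lparr>on_obj = Q_obj, on_hom = Q_hom\<rparr>"

end

theory Submission
  imports Defs
begin

text \<open>
  The elements of a circularly ordered group may be pictured as points of a circle, with the group
  acting on itself by orientation preserving maps. Its lift acts on the line that covers the circle,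
  and \<open>z\<close> is the translation by one full turn. Everything rests on passing between the two.

  From the circle to the line: cutting the circle open at a point \<open>p\<close> turns a circular order
  \<open>c\<close> into the linear order \<open>cut p\<close> with least element \<open>p\<close>, and \<open>c\<close> is recovered as the
  circular order \<open>cyclic_of (cut p)\<close> (\<open>corder_eq_cyclic_of_cut\<close>). In these terms \<open>f\<^sub>c(a, b)\<close> is
  the number of times the positive arc from \<open>a\<close> to \<open>a b\<close> runs into the identity
  (\<open>lift_cocycle_eq_cut\<close>). The cocycle identity then says that a path from \<open>a\<close> over \<open>a b\<close> to
  \<open>a b d\<close> meets the identity once more than the direct arc if it completes a full turn, and equally
  often otherwise (\<open>cut_cocycle\<close>). The order of the lift is the lexicographic order on
  \<open>\<int> \<times> G\<close>, with \<open>G\<close> cut at the identity (\<open>lless_L_obj\<close>); so it is linear and \<open>z\<close> is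
  cofinal, while left invariance is clear from the definition by a positive cone.

  From the line to the circle: since \<open>z\<close> is central and cofinal, every \<open>x\<close> in a left ordered group
  is uniquely \<open>r z\<^sup>k\<close> with \<open>id \<le> r < z\<close>, as a real number is the sum of its fractional and its
  integer part, and the order is lexicographic in \<open>(k, r)\<close> (\<open>fundamental_less_iff\<close>). The cosets of
  \<open>\<langle>z\<rangle>\<close> correspond to the fractional parts \<open>r\<close>. Left multiplication does not preserve fractional
  parts, but the circular order on them has a description by arbitrary representatives, namely
  \<open>x < y z\<^sup>m < w z\<^sup>n < x z\<close> for some \<open>m\<close> and \<open>n\<close>, and this is clearly invariant
  (\<open>cyclic_frac_part_eq_1_iff\<close>).

  The isomorphism \<open>LQ(G) \<rightarrow> G\<close> sends \<open>(n, r\<langle>z\<rangle>)\<close> to \<open>r z\<^sup>n\<close>, with \<open>r\<close> a fractional part. Both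
  orders are lexicographic, and the map is multiplicative because the cocycle of \<open>Q(G)\<close> is the
  carry: the integer part of a product of two fractional parts (\<open>lift_cocycle_Q_obj\<close>). The
  isomorphism \<open>QL(G) \<rightarrow> G\<close> sends the coset of \<open>(n, a)\<close> to \<open>a\<close>; the fractional parts of the lift
  are the elements \<open>(0, a)\<close>, ordered by \<open>cut id\<close>, so that the circular order is again \<open>c\<close>. Both
  maps are natural because a morphism of left ordered groups respects fractional parts.
\<close>

section \<open>Linear orders and circular orders\<close>

definition strict_linear_on :: "'a set \<Rightarrow> ('a \<Rightarrow> 'a \<Rightarrow> bool) \<Rightarrow> bool" where
  "strict_linear_on A lt \<longleftrightarrow> irreflp_on A lt \<and> transp_on A lt \<and> totalp_on A lt"

lemma strict_linear_onD:
  assumes "strict_linear_on A lt"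
  shows "x \<in> A \<Longrightarrow> \<not> lt x x"
    and "x \<in> A \<Longrightarrow> y \<in> A \<Longrightarrow> w \<in> A \<Longrightarrow> lt x y \<Longrightarrow> lt y w \<Longrightarrow> lt x w"
    and "x \<in> A \<Longrightarrow> y \<in> A \<Longrightarrow> x \<noteq> y \<Longrightarrow> lt x y \<or> lt y x"
    and "x \<in> A \<Longrightarrow> y \<in> A \<Longrightarrow> lt x y \<Longrightarrow> \<not> lt y x"
  using assms unfolding strict_linear_on_def irreflp_on_def transp_on_def totalp_on_def
  by blast+

definition cyclic_of :: "('a \<Rightarrow> 'a \<Rightarrow> bool) \<Rightarrow> 'a \<Rightarrow> 'a \<Rightarrow> 'a \<Rightarrow> int" where
  "cyclic_of lt x y w =
     (if lt x y \<and> lt y w \<or> lt y w \<and> lt w x \<or> lt w x \<and> lt x y then 1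
      else if lt x w \<and> lt w y \<or> lt w y \<and> lt y x \<or> lt y x \<and> lt x w then -1 else 0)"

lemma cyclic_of_eq_0_iff:
  assumes "strict_linear_on A lt" "x \<in> A" "y \<in> A" "w \<in> A"
  shows "cyclic_of lt x y w = 0 \<longleftrightarrow> x = y \<or> x = w \<or> y = w"
  using strict_linear_onD[OF assms(1)] assms(2-)
  unfolding cyclic_of_def by (smt (verit, best))

text \<open>Orientation reversal: it lets statements about circular orders be checked on the value \<open>1\<close> only.\<close>

lemma cyclic_of_eq_neg1_iff:
  assumes "strict_linear_on A lt" "x \<in> A" "y \<in> A" "w \<in> A"
  shows "cyclic_of lt x y w = -1 \<longleftrightarrow> cyclic_of lt x w y = 1"
  using strict_linear_onD[OF assms(1)] assms(2-)
  unfolding cyclic_of_def by (smt (verit, best))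

lemma cyclic_of_cocycle:
  assumes "strict_linear_on A lt" "a \<in> A" "b \<in> A" "d \<in> A" "e \<in> A"
  shows "cyclic_of lt b d e - cyclic_of lt a d e + cyclic_of lt a b e - cyclic_of lt a b d = 0"
proof -
  note D = strict_linear_onD[OF assms(1)]
  show ?thesis
    using D(1)[of a] D(1)[of b] D(1)[of d] D(1)[of e]
      D(3)[of a b] D(3)[of a d] D(3)[of a e] D(3)[of b d] D(3)[of b e] D(3)[of d e]
      D(2)[of a b d] D(2)[of a d b] D(2)[of b a d] D(2)[of b d a] D(2)[of d a b] D(2)[of d b a]
      D(2)[of a b e] D(2)[of a e b] D(2)[of b a e] D(2)[of b e a] D(2)[of e a b] D(2)[of e b a]
      D(2)[of a d e] D(2)[of a e d] D(2)[of d a e] D(2)[of d e a] D(2)[of e a d] D(2)[of e d a]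
      D(2)[of b d e] D(2)[of b e d] D(2)[of d b e] D(2)[of d e b] D(2)[of e b d] D(2)[of e d b]
      D(4)[of a b] D(4)[of a d] D(4)[of a e] D(4)[of b d] D(4)[of b e] D(4)[of d e]
      assms(2-)
    unfolding cyclic_of_def by (smt (verit))
qed

text \<open>The value \<open>1\<close> of \<open>cyclic_of\<close> collects the three even arrangements of three elements, that is, the
  rotations of the increasing one; the value \<open>-1\<close> collects the three transpositions. The sorting
  permutation is unique because it must send \<open>1\<close> to the index of the least and \<open>3\<close> to that of the
  greatest element.\<close>

lemma sign_sorting_permutation:
  assumes lin: "strict_linear_on A lt" and A: "r1 \<in> A" "r2 \<in> A" "r3 \<in> A"
    and ne: "r1 \<noteq> r2" "r1 \<noteq> r3" "r2 \<noteq> r3"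
    and r: "r = (\<lambda>i::nat. if i = 1 then r1 else if i = 2 then r2 else r3)"
  shows "sign (THE \<sigma>. \<sigma> permutes {1, 2, 3} \<and> lt (r (\<sigma> 1)) (r (\<sigma> 2)) \<and> lt (r (\<sigma> 2)) (r (\<sigma> 3)))
         = cyclic_of lt r1 r2 r3"
proof -
  note D = strict_linear_onD[OF lin]
  let ?sorts = "\<lambda>\<sigma>. \<sigma> permutes {1, 2, 3} \<and> lt (r (\<sigma> 1)) (r (\<sigma> 2)) \<and> lt (r (\<sigma> 2)) (r (\<sigma> 3))"
  have rA: "r i \<in> A" for i using A r by auto
  have extremal: "i = \<rho> 1 \<or> lt (r (\<rho> 1)) (r i)" "i = \<rho> 3 \<or> lt (r i) (r (\<rho> 3))"
    "\<rho> 1 \<in> {1, 2, 3}" "\<rho> 2 \<in> {1, 2, 3}" "\<rho> 3 \<in> {1, 2, 3}"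
    "\<rho> 1 \<noteq> \<rho> 2" "\<rho> 2 \<noteq> \<rho> 3"
    if "?sorts \<rho>" "i \<in> {1, 2, 3}" for \<rho> i
  proof -
    have "i \<in> \<rho> ` {1, 2, 3}" using that permutes_image by blast
    moreover have "lt (r (\<rho> 1)) (r (\<rho> 3))" using that D(2)[OF rA rA rA] by blast
    ultimately show "i = \<rho> 1 \<or> lt (r (\<rho> 1)) (r i)" "i = \<rho> 3 \<or> lt (r i) (r (\<rho> 3))"
      using that(1) by auto
    show "\<rho> 1 \<in> {1, 2, 3}" "\<rho> 2 \<in> {1, 2, 3}" "\<rho> 3 \<in> {1, 2, 3}"
      using that by (simp_all only: permutes_in_image) simp_all
    show "\<rho> 1 \<noteq> \<rho> 2" "\<rho> 2 \<noteq> \<rho> 3"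
      using that(1) D(1)[OF rA] by auto
  qed
  have unique: "\<sigma> = \<tau>" if s: "?sorts \<sigma>" and t: "?sorts \<tau>" for \<sigma> \<tau>
  proof
    fix i
    have *: "1 \<in> {1, 2, 3::nat}" by simp
    have 1: "\<sigma> 1 = \<tau> 1"
      using extremal(1)[OF s extremal(3)[OF t *]] extremal(1)[OF t extremal(3)[OF s *]]
        D(4)[OF rA rA] by metis
    have 3: "\<sigma> 3 = \<tau> 3"
      using extremal(2)[OF s extremal(5)[OF t *]] extremal(2)[OF t extremal(5)[OF s *]]
        D(4)[OF rA rA] by metis
    have "\<sigma> 1 \<noteq> \<sigma> 3" using s D(4)[OF rA rA] by metis
    then have 2: "\<sigma> 2 = \<tau> 2"
      using 1 3 extremal(3-7)[OF s *] extremal(3-7)[OF t *] by auto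
    show "\<sigma> i = \<tau> i"
      using s t 1 2 3 unfolding permutes_def by (cases "i \<in> {1, 2, 3}") auto
  qed
  have the: "(THE \<sigma>. ?sorts \<sigma>) = \<tau>" if "?sorts \<tau>" for \<tau>
    using that unique by blast
  consider (a) "lt r1 r2" "lt r2 r3" | (b) "lt r2 r3" "lt r3 r1" | (c) "lt r3 r1" "lt r1 r2"
    | (d) "lt r1 r3" "lt r3 r2" | (e) "lt r3 r2" "lt r2 r1" | (f) "lt r2 r1" "lt r1 r3"
    using D(3)[OF A(1,2) ne(1)] D(3)[OF A(1,3) ne(2)] D(3)[OF A(2,3) ne(3)] by blast
  then show ?thesis
  proof cases
    case a
    then show ?thesis
      using the[of id] by (simp add: permutes_id r cyclic_of_def)
  next
    case b
    let ?t = "transpose 1 2 \<circ> transpose 2 (3::nat)"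
    have "?t permutes {1,2,3}"
      by (intro permutes_compose permutes_swap_id) auto
    moreover have "sign ?t = 1"
      by (simp add: sign_compose permutation_swap_id sign_swap_id)
    ultimately show ?thesis
      using b the[of ?t] by (simp add: r cyclic_of_def transpose_def)
  next
    case c
    let ?t = "transpose 2 3 \<circ> transpose 1 (2::nat)"
    have "?t permutes {1,2,3}"
      by (intro permutes_compose permutes_swap_id) auto
    moreover have "sign ?t = 1"
      by (simp add: sign_compose permutation_swap_id sign_swap_id)
    ultimately show ?thesis
      using c the[of ?t] by (simp add: r cyclic_of_def transpose_def)
  next
    case d
    let ?t = "transpose 2 (3::nat)"
    have "?t permutes {1,2,3}" "sign ?t = -1"
      by (auto intro: permutes_swap_id simp: sign_swap_id)
    then show ?thesis
      using d the[of ?t] D(4)[OF A(1,3)] D(4)[OF A(3,2)] D(2)[OF A(1,3,2)] D(4)[OF A(1,2)]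
      by (simp add: r cyclic_of_def transpose_def)
  next
    case e
    let ?t = "transpose 1 (3::nat)"
    have "?t permutes {1,2,3}" "sign ?t = -1"
      by (auto intro: permutes_swap_id simp: sign_swap_id)
    then show ?thesis
      using e the[of ?t] D(4)[OF A(3,2)] D(4)[OF A(2,1)] D(2)[OF A(3,2,1)] D(4)[OF A(3,1)]
      by (simp add: r cyclic_of_def transpose_def)
  next
    case f
    let ?t = "transpose 1 (2::nat)"
    have "?t permutes {1,2,3}" "sign ?t = -1"
      by (auto intro: permutes_swap_id simp: sign_swap_id)
    then show ?thesis
      using f the[of ?t] D(4)[OF A(2,1)] D(4)[OF A(1,3)] D(2)[OF A(2,1,3)] D(4)[OF A(2,3)]
      by (simp add: r cyclic_of_def transpose_def)
  qed
qed

locale circ_obj = group G for G :: "'a circ_group" (structure) +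
  assumes circular: "circular_ordering G (corder G)"
begin

lemma corder_range: "x \<in> carrier G \<Longrightarrow> y \<in> carrier G \<Longrightarrow> w \<in> carrier G \<Longrightarrow>
    corder G x y w = 0 \<or> corder G x y w = 1 \<or> corder G x y w = -1"
  using circular unfolding circular_ordering_def by blast

lemma corder_eq_0_iff: "x \<in> carrier G \<Longrightarrow> y \<in> carrier G \<Longrightarrow> w \<in> carrier G \<Longrightarrow>
    corder G x y w = 0 \<longleftrightarrow> x = y \<or> x = w \<or> y = w"
  using circular unfolding circular_ordering_def by blast

lemma corder_cocycle:
  "a \<in> carrier G \<Longrightarrow> b \<in> carrier G \<Longrightarrow> d \<in> carrier G \<Longrightarrow> e \<in> carrier G \<Longrightarrow>
    corder G b d e - corder G a d e + corder G a b e - corder G a b d = 0"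
  using circular unfolding circular_ordering_def by blast

lemma corder_left: "g \<in> carrier G \<Longrightarrow> x \<in> carrier G \<Longrightarrow> y \<in> carrier G \<Longrightarrow> w \<in> carrier G \<Longrightarrow>
    corder G (g \<otimes> x) (g \<otimes> y) (g \<otimes> w) = corder G x y w"
  using circular unfolding circular_ordering_def by blast

text \<open>The cocycle condition on quadruples with a repeated entry has two vanishing terms and leaves
  the antisymmetry of \<open>c\<close>.\<close>

lemma corder_swap:
  assumes "x \<in> carrier G" "y \<in> carrier G" "w \<in> carrier G"
  shows "corder G y x w = - corder G x y w" "corder G x w y = - corder G x y w"
proof -
  have "corder G x x w = 0" "corder G x y x = 0" "corder G y w y = 0" "corder G x y y = 0"
    using assms by (simp_all add: corder_eq_0_iff)
  then show "corder G y x w = - corder G x y w" "corder G x w y = - corder G x y w"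
    using corder_cocycle[of x y x w] corder_cocycle[of x y w y] assms by auto
qed

text \<open>The linear order read along the circle in the positive direction, starting at \<open>p\<close> as the least
  element. Equivalently, \<open>cut p x y\<close> says that the positive arc from \<open>y\<close> to \<open>x\<close>, without \<open>y\<close>
  but with \<open>x\<close>, contains \<open>p\<close>.\<close>

definition cut :: "'a \<Rightarrow> 'a \<Rightarrow> 'a \<Rightarrow> bool" where
  "cut p x y \<longleftrightarrow> y \<noteq> p \<and> (x = p \<or> corder G p x y = 1)"

lemma strict_linear_cut:
  assumes p: "p \<in> carrier G"
  shows "strict_linear_on (carrier G) (cut p)"
  unfolding strict_linear_on_def irreflp_on_def transp_on_def totalp_on_def
proof (intro conjI ballI impI)
  fix x assume x: "x \<in> carrier G"
  show "\<not> cut p x x"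
    using corder_eq_0_iff[OF p x x] by (auto simp: cut_def)
next
  fix x y w assume A: "x \<in> carrier G" "y \<in> carrier G" "w \<in> carrier G"
    and xy: "cut p x y" and yw: "cut p y w"
  show "cut p x w"
    using xy yw corder_cocycle[OF p A] corder_range[OF p A(1,3)] corder_range[OF A]
    unfolding cut_def by auto
next
  fix x y assume A: "x \<in> carrier G" "y \<in> carrier G" and "x \<noteq> y"
  then show "cut p x y \<or> cut p y x"
    using corder_range[OF p A] corder_eq_0_iff[OF p A] corder_swap[OF p A]
    unfolding cut_def by auto
qed

lemma cut_irrefl: "p \<in> carrier G \<Longrightarrow> x \<in> carrier G \<Longrightarrow> \<not> cut p x x"
  using strict_linear_onD(1)[OF strict_linear_cut] .

text \<open>Cutting loses no information. By the cocycle condition \<open>c(x, y, w)\<close> is determined by the three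
  values of \<open>c\<close> at triples that contain \<open>p\<close>, and these are what \<open>cut p\<close> records.\<close>

lemma corder_eq_cyclic_of_cut:
  assumes p: "p \<in> carrier G" and A: "x \<in> carrier G" "y \<in> carrier G" "w \<in> carrier G"
  shows "corder G x y w = cyclic_of (cut p) x y w"
proof -
  define i j k l where "i = corder G p x y" and "j = corder G p x w" and "k = corder G p y w"
    and "l = corder G x y w"
  have l: "l = k - j + i"
    using corder_cocycle[OF p A] by (simp add: i_def j_def k_def l_def)
  have range: "i = 0 \<or> i = 1 \<or> i = -1" "j = 0 \<or> j = 1 \<or> j = -1" "k = 0 \<or> k = 1 \<or> k = -1"
    "l = 0 \<or> l = 1 \<or> l = -1"
    using corder_range A p unfolding i_def j_def k_def l_def by blast+
  have zero: "i = 0 \<longleftrightarrow> p = x \<or> p = y \<or> x = y" "j = 0 \<longleftrightarrow> p = x \<or> p = w \<or> x = w"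
    "k = 0 \<longleftrightarrow> p = y \<or> p = w \<or> y = w" "l = 0 \<longleftrightarrow> x = y \<or> x = w \<or> y = w"
    using corder_eq_0_iff A p unfolding i_def j_def k_def l_def by blast+
  have cuts: "cut p x y \<longleftrightarrow> y \<noteq> p \<and> (x = p \<or> i = 1)" "cut p y x \<longleftrightarrow> x \<noteq> p \<and> (y = p \<or> i = -1)"
    "cut p x w \<longleftrightarrow> w \<noteq> p \<and> (x = p \<or> j = 1)" "cut p w x \<longleftrightarrow> x \<noteq> p \<and> (w = p \<or> j = -1)"
    "cut p y w \<longleftrightarrow> w \<noteq> p \<and> (y = p \<or> k = 1)" "cut p w y \<longleftrightarrow> y \<noteq> p \<and> (w = p \<or> k = -1)"
    using corder_swap(2)[OF p A(1,2)] corder_swap(2)[OF p A(1,3)] corder_swap(2)[OF p A(2,3)]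
    unfolding cut_def i_def j_def k_def by auto
  show ?thesis
    unfolding cyclic_of_def cuts l_def[symmetric]
    using range zero l by (elim disjE) auto
qed

text \<open>Both sides count passages through \<open>s\<close>. Travelling from \<open>p\<close> to \<open>q\<close> and on to \<open>r\<close> in the positive
  direction either covers the arc from \<open>p\<close> to \<open>r\<close> exactly, or a full turn more when \<open>p\<close> is met again
  between \<open>q\<close> and \<open>r\<close>; a full turn passes \<open>s\<close> once.\<close>

lemma cut_cocycle:
  assumes s: "s \<in> carrier G" and A: "p \<in> carrier G" "q \<in> carrier G" "r \<in> carrier G"
  shows "of_bool (cut s q p) + of_bool (cut s r q) = (of_bool (cut p r q) + of_bool (cut s r p) :: int)"
proof -
  note lin = strict_linear_cut[OF s]
  have "cut p r q \<longleftrightarrow> q \<noteq> p \<and> (r = p \<or> cyclic_of (cut s) p r q = 1)"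
    using corder_eq_cyclic_of_cut[OF s A(1,3,2)] by (simp add: cut_def)
  then show ?thesis
    using strict_linear_onD[OF lin] A unfolding cyclic_of_def of_bool_def
    by (smt (verit))
qed

end

section \<open>The lift of a circularly ordered group\<close>

locale lift_obj = circ_obj G for G :: "'a universe circ_group" (structure)
begin

text \<open>The cocycle is \<open>1\<close> exactly when the positive arc from \<open>a\<close> to \<open>a b\<close> reaches the identity. In
  this form the degenerate cases of its definition need no separate treatment.\<close>

lemma lift_cocycle_eq_cut:
  assumes "a \<in> carrier G" "b \<in> carrier G"
  shows "lift_cocycle G a b = of_bool (cut \<one> (a \<otimes> b) a)"
proof -
  define j where "j = corder G \<one> a (a \<otimes> b)"
  have b: "a = a \<otimes> b \<longleftrightarrow> b = \<one>" using assms by simp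
  have swap: "corder G \<one> (a \<otimes> b) a = - j"
    using corder_swap(2)[of \<one> a "a \<otimes> b"] assms by (simp add: j_def)
  have j: "j = 0 \<or> j = 1 \<or> j = -1"
    unfolding j_def using assms by (intro corder_range) auto
  have "j = 0 \<longleftrightarrow> \<one> = a \<or> \<one> = a \<otimes> b \<or> a = a \<otimes> b"
    unfolding j_def using assms by (intro corder_eq_0_iff) auto
  then have j0: "j = 0 \<longleftrightarrow> a = \<one> \<or> a \<otimes> b = \<one> \<or> b = \<one>"
    unfolding b by auto
  have "b = \<one> \<Longrightarrow> a \<otimes> b = a" using assms by simp
  then show ?thesis
    unfolding lift_cocycle_def cut_def swap j_def[symmetric] using j j0 by auto
qed

lemma cut_mult_left:
  assumes "g \<in> carrier G" "x \<in> carrier G" "y \<in> carrier G"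
  shows "cut g (g \<otimes> x) (g \<otimes> y) \<longleftrightarrow> cut \<one> x y"
  using corder_left[of g \<one> x y] assms by (simp add: cut_def)

text \<open>This is \<open>cut_cocycle\<close> at the points \<open>id\<close>, \<open>a\<close>, \<open>a b\<close>, \<open>a b d\<close>, after \<open>lift_cocycle G b d\<close> has been
  translated by \<open>a\<close>.\<close>

lemma lift_cocycle_2cocycle:
  assumes "a \<in> carrier G" "b \<in> carrier G" "d \<in> carrier G"
  shows "lift_cocycle G a b + lift_cocycle G (a \<otimes> b) d
         = lift_cocycle G b d + lift_cocycle G a (b \<otimes> d)"
  using cut_cocycle[of \<one> a "a \<otimes> b" "a \<otimes> (b \<otimes> d)"] cut_mult_left[of a "b \<otimes> d" b] assms
  by (simp add: lift_cocycle_eq_cut m_assoc)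

lemma lift_cocycle_one:
  "lift_cocycle G \<one> b = 0" "lift_cocycle G a \<one> = 0"
  by (simp_all add: lift_cocycle_def)

lemma carrier_L_obj: "carrier (L_obj G) = {Lift n a | n a. a \<in> carrier G}"
  by (simp add: L_obj_def lift_group_def)

lemma Lift_mem: "Lift n a \<in> carrier (L_obj G) \<longleftrightarrow> a \<in> carrier G"
  by (simp add: carrier_L_obj)

lemma mult_L_obj: "Lift n a \<otimes>\<^bsub>L_obj G\<^esub> Lift m b = Lift (n + m + lift_cocycle G a b) (a \<otimes> b)"
  by (simp add: L_obj_def lift_group_def)

lemma one_L_obj: "\<one>\<^bsub>L_obj G\<^esub> = Lift 0 \<one>"
  by (simp add: L_obj_def lift_group_def)

lemma zelt_L_obj: "zelt (L_obj G) = Lift 1 \<one>"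
  by (simp add: L_obj_def)

lemma group_lift_group: "group (lift_group G)"
proof (rule groupI)
  fix x assume "x \<in> carrier (lift_group G)"
  then obtain n a where x: "x = Lift n a" "a \<in> carrier G"
    by (auto simp: lift_group_def)
  then show "\<exists>y\<in>carrier (lift_group G). y \<otimes>\<^bsub>lift_group G\<^esub> x = \<one>\<^bsub>lift_group G\<^esub>"
    by (intro bexI[of _ "Lift (- n - lift_cocycle G (inv a) a) (inv a)"])
      (auto simp: lift_group_def)
next
  fix x y w assume "x \<in> carrier (lift_group G)" "y \<in> carrier (lift_group G)"
    "w \<in> carrier (lift_group G)"
  then show "x \<otimes>\<^bsub>lift_group G\<^esub> y \<otimes>\<^bsub>lift_group G\<^esub> w
      = x \<otimes>\<^bsub>lift_group G\<^esub> (y \<otimes>\<^bsub>lift_group G\<^esub> w)"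
    using lift_cocycle_2cocycle by (auto simp: lift_group_def m_assoc)
qed (auto simp: lift_group_def lift_cocycle_one)

lemma group_L_obj: "group (L_obj G)"
proof -
  interpret T: group "lift_group G" by (rule group_lift_group)
  show ?thesis
    by (rule groupI) (auto simp: L_obj_def T.m_assoc intro: T.l_inv_ex)
qed

text \<open>The order of the lift is lexicographic. The quotient of \<open>(m, b)\<close> by \<open>(n, a)\<close> has integer entry
  \<open>m - n\<close>, lowered by one when \<open>b\<close> precedes \<open>a\<close>: this correction decides the case \<open>m = n\<close> and
  does no harm when \<open>n < m\<close>.\<close>

lemma lless_L_obj:
  assumes "a \<in> carrier G" "b \<in> carrier G"
  shows "lless (L_obj G) (Lift n a) (Lift m b) \<longleftrightarrow> n < m \<or> n = m \<and> cut \<one> a b"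
proof -
  interpret T: group "lift_group G" by (rule group_lift_group)
  define k where "k = m - n - of_bool (cut \<one> b a)"
  have ab: "a \<otimes> (inv a \<otimes> b) = b" using assms by (simp add: m_assoc[symmetric])
  have car: "Lift i d \<in> carrier (lift_group G) \<longleftrightarrow> d \<in> carrier G" for i d
    by (simp add: lift_group_def)
  have "Lift n a \<otimes>\<^bsub>lift_group G\<^esub> Lift k (inv a \<otimes> b) = Lift m b"
    using assms ab by (simp add: lift_group_def lift_cocycle_eq_cut k_def)
  then have "inv\<^bsub>lift_group G\<^esub> Lift n a \<otimes>\<^bsub>lift_group G\<^esub> Lift m b = Lift k (inv a \<otimes> b)"
    using assms T.inv_solve_left[of "Lift k (inv a \<otimes> b)" "Lift n a" "Lift m b"] by (simp add: car)
  then have "lless (L_obj G) (Lift n a) (Lift m b) \<longleftrightarrow> 0 \<le> k \<and> \<not> (k = 0 \<and> inv a \<otimes> b = \<one>)"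
    using assms by (simp add: L_obj_def less_of_cone_def lift_cone_def)
  moreover have "inv a \<otimes> b = \<one> \<longleftrightarrow> a = b"
  proof
    assume "inv a \<otimes> b = \<one>"
    then show "a = b" using ab assms by simp
  qed (use assms in simp)
  moreover have "cut \<one> b a \<longleftrightarrow> a \<noteq> b \<and> \<not> cut \<one> a b"
    using strict_linear_onD[OF strict_linear_cut[OF one_closed]] assms by blast
  moreover have "\<not> cut \<one> b b"
    using assms by (simp add: cut_irrefl)
  ultimately show ?thesis
    by (cases "cut \<one> a b"; cases "a = b") (auto simp: k_def)
qed

lemma lless_L_obj_left:
  assumes "f \<in> carrier (L_obj G)" "x \<in> carrier (L_obj G)" "y \<in> carrier (L_obj G)"
    and "lless (L_obj G) x y"
  shows "lless (L_obj G) (f \<otimes>\<^bsub>L_obj G\<^esub> x) (f \<otimes>\<^bsub>L_obj G\<^esub> y)"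
proof -
  interpret T: group "lift_group G" by (rule group_lift_group)
  have "inv\<^bsub>lift_group G\<^esub> (f \<otimes>\<^bsub>lift_group G\<^esub> x) \<otimes>\<^bsub>lift_group G\<^esub> (f \<otimes>\<^bsub>lift_group G\<^esub> y)
      = inv\<^bsub>lift_group G\<^esub> x \<otimes>\<^bsub>lift_group G\<^esub> y"
    using assms(1-3)
    by (simp add: L_obj_def T.inv_mult_group T.m_assoc) (simp add: T.m_assoc[symmetric])
  then show ?thesis
    using assms(4) by (simp add: L_obj_def less_of_cone_def)
qed

lemma int_pow_zelt_L_obj: "zelt (L_obj G) [^]\<^bsub>L_obj G\<^esub> (k::int) = Lift k \<one>"
proof -
  interpret T: group "L_obj G" by (rule group_L_obj)
  have nat: "zelt (L_obj G) [^]\<^bsub>L_obj G\<^esub> (n::nat) = Lift (int n) \<one>" for n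
    by (induction n) (auto simp: one_L_obj zelt_L_obj mult_L_obj lift_cocycle_one)
  have "inv\<^bsub>L_obj G\<^esub> Lift j \<one> = Lift (- j) \<one>" for j
    by (rule T.inv_equality) (auto simp: mult_L_obj one_L_obj Lift_mem lift_cocycle_one)
  then show ?thesis
    by (auto simp: int_pow_def2 nat)
qed

lemma left_ordering_L_obj: "left_ordering (L_obj G) (lless (L_obj G))"
  unfolding left_ordering_def
proof (intro conjI ballI impI)
  note D = strict_linear_onD[OF strict_linear_cut[OF one_closed]]
  show "irreflp_on (carrier (L_obj G)) (lless (L_obj G))"
    using D(1) by (auto intro!: irreflp_onI simp: carrier_L_obj lless_L_obj)
  show "transp_on (carrier (L_obj G)) (lless (L_obj G))"
  proof (rule transp_onI)
    fix x y w assume "x \<in> carrier (L_obj G)" "y \<in> carrier (L_obj G)" "w \<in> carrier (L_obj G)"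
      and less: "lless (L_obj G) x y" "lless (L_obj G) y w"
    then obtain n a m b k d where "x = Lift n a" "y = Lift m b" "w = Lift k d"
      and "a \<in> carrier G" "b \<in> carrier G" "d \<in> carrier G"
      by (auto simp: carrier_L_obj)
    then show "lless (L_obj G) x w"
      using less D(2)[of a b d] by (auto simp: lless_L_obj)
  qed
  show "totalp_on (carrier (L_obj G)) (lless (L_obj G))"
    by (auto intro!: totalp_onI simp: carrier_L_obj lless_L_obj) (use D(3) in blast)
qed (rule lless_L_obj_left)

lemma L_obj_in_LO_star: "L_obj G \<in> Obj LO_star"
proof -
  have "cofinal (L_obj G) (lless (L_obj G)) (zelt (L_obj G))"
    unfolding cofinal_def
  proof
    fix x assume "x \<in> carrier (L_obj G)"
    then obtain n a where "x = Lift n a" "a \<in> carrier G" by (auto simp: carrier_L_obj)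
    moreover have "- (\<bar>n\<bar> + 1) < n" "n < \<bar>n\<bar> + 1" by linarith+
    ultimately show "\<exists>k::int. lless (L_obj G) (zelt (L_obj G) [^]\<^bsub>L_obj G\<^esub> - k) x
        \<and> lless (L_obj G) x (zelt (L_obj G) [^]\<^bsub>L_obj G\<^esub> k)"
      by (intro exI[of _ "\<bar>n\<bar> + 1"]) (simp add: int_pow_zelt_L_obj lless_L_obj)
  qed
  moreover have "central (L_obj G) (zelt (L_obj G))"
    by (auto simp: central_def carrier_L_obj zelt_L_obj mult_L_obj lift_cocycle_one)
  ultimately show ?thesis
    using group_L_obj left_ordering_L_obj
    by (simp add: LO_star_def zelt_L_obj Lift_mem one_L_obj lless_L_obj)
qed

end

lemma lift_objI: "G \<in> Obj Circ \<Longrightarrow> lift_obj G"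
  by (simp add: Circ_def lift_obj_def circ_obj_def circ_obj_axioms_def)

lemma L_hom_Lift: "L_hom G H \<phi> (Lift n a) = (if a \<in> carrier G then Lift n (\<phi> a) else undefined)"
  by (simp add: L_hom_def L_obj_def lift_group_def)

text \<open>Injectivity of \<open>\<phi>\<close> is what makes it preserve \<open>cut id\<close>, whose definition tests equality with the
  identity, and hence also the cocycle.\<close>

lemma L_hom_in_lo_hom:
  assumes G: "G \<in> Obj Circ" and H: "H \<in> Obj Circ" and \<phi>: "\<phi> \<in> circ_hom G H"
  shows "L_hom G H \<phi> \<in> lo_hom (L_obj G) (L_obj H)"
proof -
  interpret G: lift_obj G by (rule lift_objI[OF G])
  interpret H: lift_obj H by (rule lift_objI[OF H])
  have hom: "\<phi> \<in> hom G H" and inj: "inj_on \<phi> (carrier G)"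
    and c: "\<And>x y w. x \<in> carrier G \<Longrightarrow> y \<in> carrier G \<Longrightarrow> w \<in> carrier G
      \<Longrightarrow> corder G x y w = corder H (\<phi> x) (\<phi> y) (\<phi> w)"
    using \<phi> by (auto simp: circ_hom_def)
  have car: "\<phi> a \<in> carrier H" if "a \<in> carrier G" for a
    using hom that by (rule hom_in_carrier)
  have mult: "\<phi> (a \<otimes>\<^bsub>G\<^esub> b) = \<phi> a \<otimes>\<^bsub>H\<^esub> \<phi> b" if "a \<in> carrier G" "b \<in> carrier G" for a b
    using hom that by (rule hom_mult)
  have one: "\<phi> \<one>\<^bsub>G\<^esub> = \<one>\<^bsub>H\<^esub>"
    using hom G.group_axioms H.group_axioms by (rule hom_one)
  have cut: "H.cut \<one>\<^bsub>H\<^esub> (\<phi> a) (\<phi> b) \<longleftrightarrow> G.cut \<one>\<^bsub>G\<^esub> a b"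
    if "a \<in> carrier G" "b \<in> carrier G" for a b
    using that c[of "\<one>\<^bsub>G\<^esub>" a b] inj_on_eq_iff[OF inj, of a "\<one>\<^bsub>G\<^esub>"]
      inj_on_eq_iff[OF inj, of b "\<one>\<^bsub>G\<^esub>"]
    by (simp add: G.cut_def H.cut_def one)
  have cocycle: "lift_cocycle H (\<phi> a) (\<phi> b) = lift_cocycle G a b"
    if "a \<in> carrier G" "b \<in> carrier G" for a b
    using that cut[of "a \<otimes>\<^bsub>G\<^esub> b" a]
    by (simp add: G.lift_cocycle_eq_cut H.lift_cocycle_eq_cut car mult)
  have "L_hom G H \<phi> \<in> hom (L_obj G) (L_obj H)"
    by (rule homI) (auto simp: G.carrier_L_obj H.carrier_L_obj L_hom_Lift car
        G.mult_L_obj H.mult_L_obj mult cocycle)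
  moreover have "lless (L_obj G) x y \<longleftrightarrow> lless (L_obj H) (L_hom G H \<phi> x) (L_hom G H \<phi> y)"
    if "x \<in> carrier (L_obj G)" "y \<in> carrier (L_obj G)" for x y
    using that by (auto simp: G.carrier_L_obj L_hom_Lift G.lless_L_obj H.lless_L_obj car cut)
  ultimately show ?thesis
    by (simp add: lo_hom_def G.zelt_L_obj H.zelt_L_obj L_hom_Lift one)
      (simp add: L_hom_def)
qed

lemma is_functor_L_functor: "is_functor Circ LO_star L_functor"
proof -
  have id: "L_hom G G (\<lambda>x\<in>carrier G. x) = (\<lambda>x\<in>carrier (L_obj G). x)" for G :: "'a universe circ_group"
    by (rule extensionalityI[of _ "carrier (L_obj G)"])
      (auto simp: L_hom_def L_obj_def lift_group_def)
  have comp: "L_hom G K (compose (carrier G) \<psi> \<phi>)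
      = compose (carrier (L_obj G)) (L_hom H K \<psi>) (L_hom G H \<phi>)"
    if "\<phi> \<in> circ_hom G H" for G H K :: "'a universe circ_group" and \<psi> \<phi>
  proof (rule extensionalityI[of _ "carrier (L_obj G)"])
    fix x assume "x \<in> carrier (L_obj G)"
    then obtain n a where "x = Lift n a" "a \<in> carrier G" by (auto simp: L_obj_def lift_group_def)
    moreover have "\<phi> a \<in> carrier H"
      using that \<open>a \<in> carrier G\<close> by (auto simp: circ_hom_def hom_def)
    ultimately show "L_hom G K (compose (carrier G) \<psi> \<phi>) x
        = compose (carrier (L_obj G)) (L_hom H K \<psi>) (L_hom G H \<phi>) x"
      using \<open>x \<in> carrier (L_obj G)\<close> by (simp add: L_hom_Lift compose_eq)
  qed (auto simp: L_hom_def)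
  show ?thesis
    using lift_obj.L_obj_in_LO_star[OF lift_objI] L_hom_in_lo_hom
    unfolding is_functor_def L_functor_def
    by (auto simp: Circ_def LO_star_def id comp)
qed

section \<open>Integer and fractional parts\<close>

locale lo_obj = group G for G :: "'a lo_group" (structure) +
  assumes left_ordered: "left_ordering G (lless G)"
    and z_closed [simp]: "zelt G \<in> carrier G"
    and z_central: "central G (zelt G)"
    and z_positive: "lless G \<one> (zelt G)"
    and z_cofinal: "cofinal G (lless G) (zelt G)"
begin

abbreviation less (infix "\<prec>" 50) where "x \<prec> y \<equiv> lless G x y"

abbreviation zpow :: "int \<Rightarrow> 'a" where "zpow k \<equiv> zelt G [^] k"

lemma linear: "strict_linear_on (carrier G) (lless G)"
  using left_ordered by (simp add: left_ordering_def strict_linear_on_def)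

lemmas less_irrefl = strict_linear_onD(1)[OF linear]
  and less_trans = strict_linear_onD(2)[OF linear]
  and less_total = strict_linear_onD(3)[OF linear]
  and less_asym = strict_linear_onD(4)[OF linear]

lemma less_left_iff:
  assumes "f \<in> carrier G" "x \<in> carrier G" "y \<in> carrier G"
  shows "f \<otimes> x \<prec> f \<otimes> y \<longleftrightarrow> x \<prec> y"
proof -
  have mono: "g \<otimes> u \<prec> g \<otimes> v" if "u \<prec> v" "g \<in> carrier G" "u \<in> carrier G" "v \<in> carrier G" for g u v
    using left_ordered that by (simp add: left_ordering_def)
  show ?thesis
    using mono[of x y f] mono[of "f \<otimes> x" "f \<otimes> y" "inv f"] assms
    by (auto simp: m_assoc[symmetric])
qed

lemma zpow_commute:
  assumes x: "x \<in> carrier G"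
  shows "zpow k \<otimes> x = x \<otimes> zpow k"
proof -
  have "zelt G [^] n \<otimes> x = x \<otimes> zelt G [^] n" for n :: nat
  proof (induction n)
    case (Suc n)
    have "zelt G [^] Suc n \<otimes> x = zelt G [^] n \<otimes> (zelt G \<otimes> x)"
      using x by (simp add: m_assoc)
    also have "\<dots> = (zelt G [^] n \<otimes> x) \<otimes> zelt G"
      using x z_central by (simp add: central_def m_assoc)
    finally show ?case
      using Suc x by (simp add: m_assoc)
  qed (use x in simp)
  then have nat: "zpow (int n) \<otimes> x = x \<otimes> zpow (int n)" for n
    by (simp add: int_pow_int)
  show ?thesis
  proof (cases "k \<ge> 0")
    case True
    then show ?thesis using nat[of "nat k"] by simp
  next
    case False
    define p where "p = zpow (- k)"
    have p: "p \<in> carrier G" "zpow k = inv p" "p \<otimes> x = x \<otimes> p"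
      using False nat[of "nat (- k)"] int_pow_neg[of "zelt G" "- k"] by (simp_all add: p_def)
    have "inv p \<otimes> x = inv p \<otimes> (x \<otimes> p) \<otimes> inv p"
      using p(1) x by (simp add: m_assoc)
    also have "\<dots> = x \<otimes> inv p"
      unfolding p(3)[symmetric] using p(1) x by (simp add: m_assoc[symmetric])
    finally show ?thesis using p by simp
  qed
qed

lemma mult_zpow_zpow: "x \<in> carrier G \<Longrightarrow> x \<otimes> zpow m \<otimes> zpow n = x \<otimes> zpow (m + n)"
  by (simp add: m_assoc int_pow_mult)

lemma less_zpow_cancel:
  assumes "x \<in> carrier G" "y \<in> carrier G"
  shows "x \<otimes> zpow k \<prec> y \<otimes> zpow k \<longleftrightarrow> x \<prec> y"
  using less_left_iff[of "zpow k" x y] assms by (simp add: zpow_commute)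

text \<open>The map \<open>k \<mapsto> z\<^sup>k\<close> embeds the ordered group of integers, because \<open>z\<close> is positive.\<close>

lemma zpow_less_iff: "zpow m \<prec> zpow n \<longleftrightarrow> m < n"
proof -
  have pos: "\<one> \<prec> zelt G [^] Suc n" for n :: nat
  proof (induction n)
    case (Suc n)
    have "zelt G [^] Suc n \<otimes> \<one> \<prec> zelt G [^] Suc n \<otimes> zelt G"
      using z_positive by (subst less_left_iff) auto
    then have "zelt G [^] Suc n \<prec> zelt G [^] Suc (Suc n)" by simp
    with Suc show ?case by (rule less_trans[rotated 3]) auto
  qed (use z_positive in simp)
  have up: "zpow m \<prec> zpow n" if "m < n" for m n
  proof -
    from that obtain i where "n = m + int (Suc i)"
      unfolding zless_iff_Suc_zadd by blast
    then have n: "zpow n = zpow m \<otimes> zelt G [^] Suc i"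
      by (metis int_pow_int int_pow_mult z_closed)
    have "zpow m \<otimes> \<one> \<prec> zpow m \<otimes> zelt G [^] Suc i"
      using pos[of i] by (subst less_left_iff) auto
    then show ?thesis using n by simp
  qed
  show ?thesis
    using up[of m n] up[of n m] less_asym[of "zpow m" "zpow n"] less_irrefl[of "zpow m"]
    by (cases m n rule: linorder_cases) auto
qed

text \<open>A fundamental domain for the translation by \<open>z\<close>, the analogue of the half-open unit interval.\<close>

definition fundamental :: "'a set" where
  "fundamental = {r \<in> carrier G. (\<one> = r \<or> \<one> \<prec> r) \<and> r \<prec> zelt G}"

lemma fundamental_closed: "r \<in> fundamental \<Longrightarrow> r \<in> carrier G"
  by (simp add: fundamental_def)

lemma one_fundamental: "\<one> \<in> fundamental"
  using z_positive by (simp add: fundamental_def)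

text \<open>If \<open>m < n\<close> then \<open>r z\<^sup>m < z\<^bsup>m + 1\<^esup> \<le> z\<^sup>n \<le> s z\<^sup>n\<close>; if \<open>m = n\<close> then the central factor cancels.\<close>

lemma fundamental_less_iff:
  assumes r: "r \<in> fundamental" and s: "s \<in> fundamental"
  shows "r \<otimes> zpow m \<prec> s \<otimes> zpow n \<longleftrightarrow> m < n \<or> m = n \<and> r \<prec> s"
proof -
  have jump: "u \<otimes> zpow m \<prec> v \<otimes> zpow n"
    if u: "u \<in> fundamental" and v: "v \<in> fundamental" and "m < n" for u v m n
  proof -
    have "u \<otimes> zpow m \<prec> zelt G \<otimes> zpow m"
      using u by (simp add: fundamental_def less_zpow_cancel)
    moreover have "zelt G \<otimes> zpow m = zpow (1 + m)"
      by (subst int_pow_mult) simp_all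
    moreover have "zpow (1 + m) = zpow n \<or> zpow (1 + m) \<prec> zpow n"
      using \<open>m < n\<close> zpow_less_iff[of "1 + m" n] by (cases "1 + m = n") auto
    ultimately have "u \<otimes> zpow m \<prec> zpow n"
      using less_trans[of "u \<otimes> zpow m" "zpow (1 + m)" "zpow n"] fundamental_closed[OF u]
      by auto
    moreover have "zpow n = v \<otimes> zpow n \<or> zpow n \<prec> v \<otimes> zpow n"
      using v less_zpow_cancel[of \<one> v n] by (auto simp: fundamental_def)
    ultimately show ?thesis
      using less_trans[of "u \<otimes> zpow m" "zpow n" "v \<otimes> zpow n"] fundamental_closed[OF u]
        fundamental_closed[OF v] by auto
  qed
  show ?thesis
    using jump[OF r s, of m n] jump[OF s r, of n m] less_zpow_cancel[of r s]
      less_asym[of "r \<otimes> zpow m" "s \<otimes> zpow n"] r s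
    by (cases m n rule: linorder_cases) (auto simp: fundamental_closed)
qed

lemma fundamental_decomp_unique:
  assumes "r \<in> fundamental" "s \<in> fundamental" "r \<otimes> zpow m = s \<otimes> zpow n"
  shows "m = n \<and> r = s"
proof -
  have c: "r \<in> carrier G" "s \<in> carrier G" using assms fundamental_closed by auto
  have "\<not> r \<otimes> zpow m \<prec> s \<otimes> zpow n" "\<not> s \<otimes> zpow n \<prec> r \<otimes> zpow m"
    using assms(3) less_irrefl[of "s \<otimes> zpow n"] c by auto
  then show ?thesis
    using assms(1,2) less_total[OF c] by (auto simp: fundamental_less_iff)
qed

text \<open>By cofinality \<open>x\<close> lies between \<open>z\<^bsup>-k\<^esup>\<close> and \<open>z\<^sup>k\<close>, so there is a last power of \<open>z\<close> that does not
  exceed \<open>x\<close>; dividing by it gives the representative.\<close>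

lemma ex_fundamental_decomp:
  assumes x: "x \<in> carrier G"
  shows "\<exists>k r. r \<in> fundamental \<and> x = r \<otimes> zpow k"
proof -
  obtain k where k: "zpow (- k) \<prec> x" "x \<prec> zpow k"
    using z_cofinal x unfolding cofinal_def by blast
  have "zpow (- k) \<prec> zpow k"
    using less_trans[OF _ _ _ k] x by simp
  then have "k > 0" by (simp add: zpow_less_iff)
  \<comment> \<open>The powers are indexed by naturals, starting at the lower bound, to find the last one below \<open>x\<close>.\<close>
  define P where "P i \<longleftrightarrow> x \<prec> zpow (- k + int i)" for i
  have "P (nat (2 * k))" "\<not> P 0"
    using k \<open>k > 0\<close> less_asym[of x "zpow (- k)"] x by (auto simp: P_def)
  then obtain i where i: "\<not> P i" "P (Suc i)"
    using ex_least_nat_less by blast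
  define j where "j = - k + int i"
  have j: "\<not> x \<prec> zpow j" "x \<prec> zpow (j + 1)"
    using i by (simp_all add: P_def j_def algebra_simps)
  define r where "r = x \<otimes> zpow (- j)"
  have r: "r \<in> carrier G" and xr: "x = r \<otimes> zpow j"
    using x by (simp_all add: r_def mult_zpow_zpow)
  have "\<not> r \<prec> \<one>" "r \<prec> zelt G"
    using j less_zpow_cancel[of r \<one> j] less_zpow_cancel[of r "zelt G" j] r
    by (simp_all add: xr int_pow_mult zpow_commute)
  then have "r \<in> fundamental"
    using r less_total[of r \<one>] by (auto simp: fundamental_def)
  with xr show ?thesis by blast
qed

definition int_part :: "'a \<Rightarrow> int" where
  "int_part x = (THE k. \<exists>r\<in>fundamental. x = r \<otimes> zpow k)"

definition frac_part :: "'a \<Rightarrow> 'a" where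
  "frac_part x = (THE r. r \<in> fundamental \<and> (\<exists>k. x = r \<otimes> zpow k))"

lemma parts_of_decomp:
  assumes "r \<in> fundamental"
  shows int_part_decomp: "int_part (r \<otimes> zpow k) = k"
    and frac_part_decomp: "frac_part (r \<otimes> zpow k) = r"
  using assms fundamental_decomp_unique unfolding int_part_def frac_part_def
  by (blast intro!: the_equality)+

lemma frac_part_fundamental: "x \<in> carrier G \<Longrightarrow> frac_part x \<in> fundamental"
  and decomp: "x \<in> carrier G \<Longrightarrow> frac_part x \<otimes> zpow (int_part x) = x"
  using ex_fundamental_decomp parts_of_decomp by metis+

lemma frac_part_closed: "x \<in> carrier G \<Longrightarrow> frac_part x \<in> carrier G"
  using frac_part_fundamental fundamental_closed by blast

lemma frac_part_of_fundamental: "r \<in> fundamental \<Longrightarrow> frac_part r = r"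
  using frac_part_decomp[of r 0] by (simp add: fundamental_closed)

text \<open>The carry. For \<open>r\<close> and \<open>s\<close> in the fundamental domain, \<open>r \<le> r s < r z\<close>, so the integer part is
  \<open>0\<close> or \<open>1\<close>; it is \<open>1\<close> exactly when passing to the fractional part jumps back below \<open>r\<close>.\<close>

lemma int_part_mult_fundamental:
  assumes r: "r \<in> fundamental" and s: "s \<in> fundamental"
  shows "int_part (r \<otimes> s) = of_bool (frac_part (r \<otimes> s) \<prec> r)"
proof -
  have c: "r \<in> carrier G" "s \<in> carrier G" using r s fundamental_closed by auto
  define t k where "t = frac_part (r \<otimes> s)" and "k = int_part (r \<otimes> s)"
  have t: "t \<in> fundamental" and tk: "r \<otimes> s = t \<otimes> zpow k"
    using c by (simp_all add: t_def k_def frac_part_fundamental decomp)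
  have "\<not> s \<prec> \<one>" "s \<prec> zelt G"
    using s less_asym[of \<one> s] less_irrefl[of \<one>] by (auto simp: fundamental_def)
  then have "\<not> r \<otimes> s \<prec> r \<otimes> zpow 0" "r \<otimes> s \<prec> r \<otimes> zpow 1"
    using less_left_iff[of r s \<one>] less_left_iff[of r s "zelt G"] c by simp_all
  then have "k = of_bool (t \<prec> r)"
    unfolding tk fundamental_less_iff[OF t r] by auto
  then show ?thesis by (simp add: k_def t_def)
qed

section \<open>The quotient\<close>

text \<open>Three cosets are positively oriented when, going upwards on the line from a representative \<open>x\<close> of
  the first, the second and then the third are met before the first recurs at \<open>x z\<close>. The right-hand
  side is insensitive to the choice of representatives and to left multiplication, whereas the left
  one is what the definition of the quotient order computes.\<close>

lemma cyclic_frac_part_eq_1_iff: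
  assumes c: "x \<in> carrier G" "y \<in> carrier G" "w \<in> carrier G"
  shows "cyclic_of (lless G) (frac_part x) (frac_part y) (frac_part w) = 1 \<longleftrightarrow>
    (\<exists>m n. x \<prec> y \<otimes> zpow m \<and> y \<otimes> zpow m \<prec> w \<otimes> zpow n \<and> w \<otimes> zpow n \<prec> x \<otimes> zpow 1)"
proof -
  define a b d i j k where "a = frac_part x" and "b = frac_part y" and "d = frac_part w"
    and "i = int_part x" and "j = int_part y" and "k = int_part w"
  have F: "a \<in> fundamental" "b \<in> fundamental" "d \<in> fundamental"
    using c by (simp_all add: a_def b_def d_def frac_part_fundamental)
  have F': "a \<in> carrier G" "b \<in> carrier G" "d \<in> carrier G"
    using F fundamental_closed by auto
  have x: "x = a \<otimes> zpow i" and y: "y = b \<otimes> zpow j" and w: "w = d \<otimes> zpow k"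
    using c by (simp_all add: a_def b_def d_def i_def j_def k_def decomp)
  have "(\<exists>m n. x \<prec> y \<otimes> zpow m \<and> y \<otimes> zpow m \<prec> w \<otimes> zpow n \<and> w \<otimes> zpow n \<prec> x \<otimes> zpow 1)
    \<longleftrightarrow> (\<exists>m n. (i < j + m \<or> i = j + m \<and> a \<prec> b) \<and> (j + m < k + n \<or> j + m = k + n \<and> b \<prec> d)
          \<and> (k + n < i + 1 \<or> k + n = i + 1 \<and> d \<prec> a))"
    using F by (simp only: x y w mult_zpow_zpow F' fundamental_less_iff)
  \<comment> \<open>Shifting \<open>m\<close> and \<open>n\<close> replaces the three representatives by their fractional parts.\<close>
  also have "\<dots> \<longleftrightarrow> (\<exists>m n. (0 < m \<or> 0 = m \<and> a \<prec> b) \<and> (m < n \<or> m = n \<and> b \<prec> d)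
          \<and> (n < 1 \<or> n = (1::int) \<and> d \<prec> a))" (is "?L \<longleftrightarrow> ?R")
  proof
    assume ?L
    then obtain m n where "(i < j + m \<or> i = j + m \<and> a \<prec> b)"
      "(j + m < k + n \<or> j + m = k + n \<and> b \<prec> d)" "(k + n < i + 1 \<or> k + n = i + 1 \<and> d \<prec> a)"
      by blast
    then show ?R
      by - (rule exI[of _ "j + m - i"], rule exI[of _ "k + n - i"], linarith)
  next
    assume ?R
    then obtain m n :: int where "(0 < m \<or> 0 = m \<and> a \<prec> b)"
      "(m < n \<or> m = n \<and> b \<prec> d)" "(n < 1 \<or> n = 1 \<and> d \<prec> a)"
      by blast
    then show ?L
      by - (rule exI[of _ "m + i - j"], rule exI[of _ "n + i - k"], linarith)
  qed
  also have "\<dots> \<longleftrightarrow> a \<prec> b \<and> b \<prec> d \<or> b \<prec> d \<and> d \<prec> a \<or> d \<prec> a \<and> a \<prec> b" (is "_ \<longleftrightarrow> ?C")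
  proof
    assume "\<exists>m n. (0 < m \<or> 0 = m \<and> a \<prec> b) \<and> (m < n \<or> m = n \<and> b \<prec> d)
          \<and> (n < 1 \<or> n = (1::int) \<and> d \<prec> a)"
    then obtain m n :: int where *: "0 < m \<or> 0 = m \<and> a \<prec> b" "m < n \<or> m = n \<and> b \<prec> d"
      "n < 1 \<or> n = 1 \<and> d \<prec> a" by blast
    \<comment> \<open>The bounds \<open>0 \<le> m \<le> n \<le> 1\<close> leave one case for each of the three positive arrangements.\<close>
    then consider "m = 0" "n = 0" | "m = 0" "n = 1" | "m = 1" "n = 1" by linarith
    then show ?C using * by cases auto
  next
    assume ?C
    then consider "a \<prec> b" "b \<prec> d" | "b \<prec> d" "d \<prec> a" | "d \<prec> a" "a \<prec> b" by blast
    then show "\<exists>m n. (0 < m \<or> 0 = m \<and> a \<prec> b) \<and> (m < n \<or> m = n \<and> b \<prec> d)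
          \<and> (n < 1 \<or> n = (1::int) \<and> d \<prec> a)"
    proof cases
      case 1 then show ?thesis by (intro exI[of _ 0]) auto
    next
      case 2 then show ?thesis by (intro exI[of _ 1]) auto
    next
      case 3 then show ?thesis by - (rule exI[of _ 0], rule exI[of _ 1], auto)
    qed
  qed
  also have "\<dots> \<longleftrightarrow> cyclic_of (lless G) a b d = 1"
    by (simp add: cyclic_of_def)
  finally show ?thesis
    by (simp add: a_def b_def d_def)
qed

text \<open>The value \<open>1\<close> is invariant by the preceding characterization, the value \<open>-1\<close> because it is the
  value \<open>1\<close> of a permuted triple, and there is only one further value.\<close>

lemma cyclic_frac_part_left:
  assumes g: "g \<in> carrier G" and c: "x \<in> carrier G" "y \<in> carrier G" "w \<in> carrier G"
  shows "cyclic_of (lless G) (frac_part (g \<otimes> x)) (frac_part (g \<otimes> y)) (frac_part (g \<otimes> w))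
    = cyclic_of (lless G) (frac_part x) (frac_part y) (frac_part w)"
proof -
  let ?c = "\<lambda>x y w. cyclic_of (lless G) (frac_part x) (frac_part y) (frac_part w)"
  have one: "?c (g \<otimes> x) (g \<otimes> y) (g \<otimes> w) = 1 \<longleftrightarrow> ?c x y w = 1"
    if "x \<in> carrier G" "y \<in> carrier G" "w \<in> carrier G" for x y w
    using that g by (simp add: cyclic_frac_part_eq_1_iff m_assoc less_left_iff)
  have "?c (g \<otimes> x) (g \<otimes> y) (g \<otimes> w) = -1 \<longleftrightarrow> ?c x y w = -1"
    using one[OF c(1,3,2)] c g cyclic_of_eq_neg1_iff[OF linear]
    by (simp add: frac_part_closed)
  moreover have "?c x y w \<in> {0, 1, -1}" for x y w
    by (simp add: cyclic_of_def)
  ultimately show ?thesis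
    using one[OF c] by (smt (verit) insert_iff singletonD)
qed

lemma zsub_eq: "zsub G = range zpow"
  using generate_pow[OF z_closed] by auto

lemma normal_zsub: "zsub G \<lhd> G"
proof -
  have "x \<otimes> h \<otimes> inv x \<in> zsub G" if "x \<in> carrier G" "h \<in> zsub G" for x h
  proof -
    from that(2) obtain k where h: "h = zpow k" unfolding zsub_eq by blast
    have "x \<otimes> h \<otimes> inv x = h \<otimes> (x \<otimes> inv x)"
      using that by (simp add: h zpow_commute[symmetric] m_assoc del: r_inv)
    then show ?thesis using that by (simp add: h zsub_eq)
  qed
  then show ?thesis
    using generate_is_subgroup[of "{zelt G}"] by (simp add: normal_inv_iff)
qed

lemma coset_eq: "x \<in> carrier G \<Longrightarrow> zsub G #> x = range (\<lambda>k. frac_part x \<otimes> zpow k)"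
proof -
  assume x: "x \<in> carrier G"
  have "zpow k \<otimes> x = frac_part x \<otimes> zpow (int_part x + k)" for k
    using x decomp[OF x] by (metis frac_part_closed mult_zpow_zpow zpow_commute)
  moreover have "range (\<lambda>k. frac_part x \<otimes> zpow k) = range (\<lambda>k. frac_part x \<otimes> zpow (int_part x + k))"
    by (auto simp: image_iff) (metis add.commute diff_add_cancel)
  ultimately show ?thesis
    by (auto simp: zsub_eq r_coset_def)
qed

lemma coset_eq_iff:
  assumes "x \<in> carrier G" "y \<in> carrier G"
  shows "zsub G #> x = zsub G #> y \<longleftrightarrow> frac_part x = frac_part y"
proof
  assume "zsub G #> x = zsub G #> y"
  then have "frac_part x \<otimes> zpow 0 \<in> range (\<lambda>k. frac_part y \<otimes> zpow k)"
    using coset_eq assms by blast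
  then show "frac_part x = frac_part y"
    using fundamental_decomp_unique frac_part_fundamental assms by blast
qed (use coset_eq assms in simp)

lemma min_rep_coset:
  assumes "x \<in> carrier G"
  shows "min_rep G (zsub G #> x) = frac_part x"
  unfolding min_rep_def
proof (rule the_equality)
  show "frac_part x \<in> zsub G #> x \<and> (\<one> = frac_part x \<or> \<one> \<prec> frac_part x) \<and> frac_part x \<prec> zelt G"
    using frac_part_fundamental[OF assms] rangeI[of "\<lambda>k. frac_part x \<otimes> zpow k" 0]
    by (simp add: coset_eq[OF assms] fundamental_def)
next
  fix h assume h: "h \<in> zsub G #> x \<and> (\<one> = h \<or> \<one> \<prec> h) \<and> h \<prec> zelt G"
  then obtain k where k: "h = frac_part x \<otimes> zpow k" using coset_eq[OF assms] by blast
  then have "h \<in> fundamental"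
    using h frac_part_closed[OF assms] by (simp add: fundamental_def)
  then show "h = frac_part x"
    using k frac_part_decomp[OF frac_part_fundamental[OF assms]] frac_part_of_fundamental by metis
qed

lemma quotient_corder_coset:
  assumes c: "x \<in> carrier G" "y \<in> carrier G" "w \<in> carrier G"
  shows "quotient_corder G (zsub G #> x) (zsub G #> y) (zsub G #> w)
    = cyclic_of (lless G) (frac_part x) (frac_part y) (frac_part w)"
proof (cases "frac_part x = frac_part y \<or> frac_part x = frac_part w \<or> frac_part y = frac_part w")
  case True
  then show ?thesis
    using cyclic_of_eq_0_iff[OF linear, of "frac_part x" "frac_part y" "frac_part w"] c
    by (auto simp: quotient_corder_def coset_eq_iff frac_part_closed)
next
  case False
  define r where "r = (\<lambda>i::nat. min_rep G
    (if i = 1 then zsub G #> x else if i = 2 then zsub G #> y else zsub G #> w))"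
  have "r = (\<lambda>i. if i = 1 then frac_part x else if i = 2 then frac_part y else frac_part w)"
    using c by (auto simp: r_def min_rep_coset)
  from sign_sorting_permutation[OF linear _ _ _ _ _ _ this]
  show ?thesis
    using False c unfolding quotient_corder_def Let_def r_def[symmetric]
    by (simp add: coset_eq_iff frac_part_closed)
qed

end

definition zcoset :: "'a universe lo_group \<Rightarrow> 'a universe \<Rightarrow> 'a universe" where
  "zcoset G x = encode_set (zsub G #>\<^bsub>G\<^esub> x)"

locale quotient_obj = lo_obj G for G :: "'a universe lo_group" (structure)
begin

lemma decode_zcoset: "x \<in> carrier G \<Longrightarrow> decode_set (zcoset G x) = zsub G #> x"
  unfolding zcoset_def by (intro decode_encode_set) (simp add: coset_eq)

lemma zcoset_eq_iff:
  "x \<in> carrier G \<Longrightarrow> y \<in> carrier G \<Longrightarrow> zcoset G x = zcoset G y \<longleftrightarrow> frac_part x = frac_part y"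
  by (metis coset_eq_iff decode_zcoset zcoset_def)

lemma zcoset_frac_part: "x \<in> carrier G \<Longrightarrow> zcoset G (frac_part x) = zcoset G x"
  by (simp add: zcoset_eq_iff frac_part_closed frac_part_of_fundamental frac_part_fundamental)

lemma carrier_Q_obj: "carrier (Q_obj G) = zcoset G ` carrier G"
  by (simp add: Q_obj_def carrier_FactGroup zcoset_def image_image)

lemma zcoset_closed: "x \<in> carrier G \<Longrightarrow> zcoset G x \<in> carrier (Q_obj G)"
  by (simp add: carrier_Q_obj)

lemma mult_Q_obj:
  assumes "x \<in> carrier G" "y \<in> carrier G"
  shows "zcoset G x \<otimes>\<^bsub>Q_obj G\<^esub> zcoset G y = zcoset G (x \<otimes> y)"
  using normal.rcos_sum[OF normal_zsub assms] assms
  by (simp add: Q_obj_def decode_zcoset) (simp add: zcoset_def)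

lemma one_Q_obj: "\<one>\<^bsub>Q_obj G\<^esub> = zcoset G \<one>"
proof -
  have "zsub G \<subseteq> carrier G" by (auto simp: zsub_eq)
  then show ?thesis by (simp add: Q_obj_def zcoset_def coset_mult_one)
qed

lemma corder_Q_obj:
  assumes "x \<in> carrier G" "y \<in> carrier G" "w \<in> carrier G"
  shows "corder (Q_obj G) (zcoset G x) (zcoset G y) (zcoset G w)
    = cyclic_of (lless G) (frac_part x) (frac_part y) (frac_part w)"
  using assms by (simp add: Q_obj_def decode_zcoset quotient_corder_coset)

lemma group_Q_obj: "group (Q_obj G)"
proof (rule groupI)
  fix X assume "X \<in> carrier (Q_obj G)"
  then obtain x where "X = zcoset G x" "x \<in> carrier G" by (auto simp: carrier_Q_obj)
  then show "\<exists>Y\<in>carrier (Q_obj G). Y \<otimes>\<^bsub>Q_obj G\<^esub> X = \<one>\<^bsub>Q_obj G\<^esub>"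
    by (intro bexI[of _ "zcoset G (inv x)"]) (auto simp: mult_Q_obj one_Q_obj zcoset_closed)
qed (auto simp: carrier_Q_obj mult_Q_obj one_Q_obj m_assoc)

lemma circular_ordering_Q_obj: "circular_ordering (Q_obj G) (corder (Q_obj G))"
  unfolding circular_ordering_def carrier_Q_obj ball_simps(9)
proof (intro conjI ballI)
  fix x y w assume c: "x \<in> carrier G" "y \<in> carrier G" "w \<in> carrier G"
  show "corder (Q_obj G) (zcoset G x) (zcoset G y) (zcoset G w) \<in> {0, 1, -1}"
    using c by (simp add: corder_Q_obj cyclic_of_def)
  show "corder (Q_obj G) (zcoset G x) (zcoset G y) (zcoset G w) = 0 \<longleftrightarrow>
      zcoset G x = zcoset G y \<or> zcoset G x = zcoset G w \<or> zcoset G y = zcoset G w"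
    using c by (simp add: corder_Q_obj cyclic_of_eq_0_iff[OF linear] frac_part_closed zcoset_eq_iff)
next
  fix x y w v assume "x \<in> carrier G" "y \<in> carrier G" "w \<in> carrier G" "v \<in> carrier G"
  then show "corder (Q_obj G) (zcoset G y) (zcoset G w) (zcoset G v)
      - corder (Q_obj G) (zcoset G x) (zcoset G w) (zcoset G v)
      + corder (Q_obj G) (zcoset G x) (zcoset G y) (zcoset G v)
      - corder (Q_obj G) (zcoset G x) (zcoset G y) (zcoset G w) = 0"
    by (simp add: corder_Q_obj cyclic_of_cocycle[OF linear] frac_part_closed)
next
  fix g x y w assume "g \<in> carrier G" "x \<in> carrier G" "y \<in> carrier G" "w \<in> carrier G"
  then show "corder (Q_obj G) (zcoset G g \<otimes>\<^bsub>Q_obj G\<^esub> zcoset G x)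
      (zcoset G g \<otimes>\<^bsub>Q_obj G\<^esub> zcoset G y) (zcoset G g \<otimes>\<^bsub>Q_obj G\<^esub> zcoset G w)
      = corder (Q_obj G) (zcoset G x) (zcoset G y) (zcoset G w)"
    by (simp add: mult_Q_obj corder_Q_obj cyclic_frac_part_left)
qed

lemma Q_obj_in_Circ: "Q_obj G \<in> Obj Circ"
  using group_Q_obj circular_ordering_Q_obj by (simp add: Circ_def)

text \<open>Cutting the quotient circle at the trivial coset gives back the linear order of the fundamental
  domain, as the identity is its least element.\<close>

lemma cut_Q_obj:
  assumes "x \<in> carrier G" "y \<in> carrier G"
  shows "circ_obj.cut (Q_obj G) \<one>\<^bsub>Q_obj G\<^esub> (zcoset G x) (zcoset G y)
    \<longleftrightarrow> frac_part x \<prec> frac_part y"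
proof -
  interpret Q: lift_obj "Q_obj G" by (rule lift_objI[OF Q_obj_in_Circ])
  have one: "frac_part \<one> = \<one>"
    by (rule frac_part_of_fundamental[OF one_fundamental])
  have min: "\<one> = frac_part w \<or> \<one> \<prec> frac_part w" "\<not> frac_part w \<prec> \<one>"
    "\<not> frac_part w \<prec> frac_part w"
    if "w \<in> carrier G" for w
    using frac_part_fundamental[OF that] less_asym[of \<one> "frac_part w"]
      less_irrefl[of "frac_part w"] frac_part_closed[OF that]
    by (auto simp: fundamental_def)
  have "cyclic_of (lless G) \<one> (frac_part x) (frac_part y) = 1
      \<longleftrightarrow> \<one> \<prec> frac_part x \<and> frac_part x \<prec> frac_part y"
    using min(2)[OF assms(1)] min(2)[OF assms(2)] by (simp add: cyclic_of_def)
  moreover have "Q.cut \<one>\<^bsub>Q_obj G\<^esub> (zcoset G x) (zcoset G y) \<longleftrightarrow> frac_part y \<noteq> \<one> \<and>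
      (frac_part x = \<one> \<or> cyclic_of (lless G) \<one> (frac_part x) (frac_part y) = 1)"
    using assms by (simp add: Q.cut_def one_Q_obj zcoset_eq_iff corder_Q_obj one)
  ultimately show ?thesis
    using min[OF assms(1)] min[OF assms(2)] by metis
qed

text \<open>The cocycle of the quotient is the carry, since both are described by comparing \<open>r s\<close> with \<open>r\<close>
  modulo \<open>z\<close>.\<close>

lemma lift_cocycle_Q_obj:
  assumes "r \<in> fundamental" "s \<in> fundamental"
  shows "lift_cocycle (Q_obj G) (zcoset G r) (zcoset G s) = int_part (r \<otimes> s)"
proof -
  interpret Q: lift_obj "Q_obj G" by (rule lift_objI[OF Q_obj_in_Circ])
  have "r \<in> carrier G" "s \<in> carrier G" using assms fundamental_closed by auto
  then show ?thesis
    using assms by (simp add: Q.lift_cocycle_eq_cut zcoset_closed mult_Q_obj cut_Q_obj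
        int_part_mult_fundamental frac_part_of_fundamental)
qed

end

lemma quotient_objI: "G \<in> Obj LO_star \<Longrightarrow> quotient_obj G"
  by (simp add: LO_star_def quotient_obj_def lo_obj_def lo_obj_axioms_def)

locale lo_morphism = dom: quotient_obj G + cod: quotient_obj H
  for G H :: "'a universe lo_group" and \<theta> :: "'a universe \<Rightarrow> 'a universe" +
  assumes morphism: "\<theta> \<in> lo_hom G H"
begin

lemma hom: "\<theta> \<in> hom G H"
  and less_iff: "x \<in> carrier G \<Longrightarrow> y \<in> carrier G \<Longrightarrow> lless H (\<theta> x) (\<theta> y) \<longleftrightarrow> lless G x y"
  and zelt: "\<theta> (zelt G) = zelt H"
  using morphism by (auto simp: lo_hom_def)

lemma closed: "x \<in> carrier G \<Longrightarrow> \<theta> x \<in> carrier H"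
  using hom by (rule hom_in_carrier)

lemma one: "\<theta> \<one>\<^bsub>G\<^esub> = \<one>\<^bsub>H\<^esub>"
  using hom dom.group_axioms cod.group_axioms by (rule hom_one)

lemma mult: "x \<in> carrier G \<Longrightarrow> y \<in> carrier G \<Longrightarrow> \<theta> (x \<otimes>\<^bsub>G\<^esub> y) = \<theta> x \<otimes>\<^bsub>H\<^esub> \<theta> y"
  using hom by (rule hom_mult)

lemma inj: "inj_on \<theta> (carrier G)"
  using less_iff closed dom.less_total cod.less_irrefl by (metis inj_onI)

lemma zpow: "\<theta> (dom.zpow k) = cod.zpow k"
  using hom_int_pow[OF hom] dom.group_axioms cod.group_axioms zelt dom.z_closed by metis

lemma fundamental: "r \<in> dom.fundamental \<Longrightarrow> \<theta> r \<in> cod.fundamental"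
  using less_iff[of "\<one>\<^bsub>G\<^esub>" r] less_iff[of r "zelt G"]
  by (auto simp: dom.fundamental_def cod.fundamental_def closed one zelt)

text \<open>The image under \<open>\<theta>\<close> of the decomposition of \<open>x\<close> is a decomposition of \<open>\<theta> x\<close>, so uniqueness
  applies. This makes \<open>Q\<close> well defined on morphisms and gives the naturality of \<open>LQ_iso\<close>.\<close>

lemma frac_part: "x \<in> carrier G \<Longrightarrow> cod.frac_part (\<theta> x) = \<theta> (dom.frac_part x)"
  by (metis fundamental cod.frac_part_decomp dom.decomp dom.frac_part_closed
      dom.frac_part_fundamental dom.int_pow_closed dom.z_closed mult zpow)

lemma Q_hom_zcoset:
  assumes x: "x \<in> carrier G"
  shows "Q_hom G H \<theta> (zcoset G x) = zcoset H (\<theta> x)"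
proof -
  have "(THE y. \<exists>g\<in>carrier G. zcoset G x = zcoset G g \<and> y = zcoset H (\<theta> g)) = zcoset H (\<theta> x)"
  proof (rule the_equality)
    fix y assume "\<exists>g\<in>carrier G. zcoset G x = zcoset G g \<and> y = zcoset H (\<theta> g)"
    then show "y = zcoset H (\<theta> x)"
      using x by (auto simp: dom.zcoset_eq_iff cod.zcoset_eq_iff closed frac_part)
  qed (use x in blast)
  then show ?thesis
    using dom.zcoset_closed[OF x] by (simp add: Q_hom_def zcoset_def)
qed

lemma cyclic_of_image:
  "x \<in> carrier G \<Longrightarrow> y \<in> carrier G \<Longrightarrow> w \<in> carrier G \<Longrightarrow>
    cyclic_of (lless H) (\<theta> x) (\<theta> y) (\<theta> w) = cyclic_of (lless G) x y w"
  by (simp add: cyclic_of_def less_iff)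

lemma Q_hom_in_circ_hom: "Q_hom G H \<theta> \<in> circ_hom (Q_obj G) (Q_obj H)"
proof -
  have "Q_hom G H \<theta> \<in> hom (Q_obj G) (Q_obj H)"
    by (rule homI) (auto simp: dom.carrier_Q_obj Q_hom_zcoset cod.zcoset_closed closed
        dom.mult_Q_obj cod.mult_Q_obj mult)
  moreover have "inj_on (Q_hom G H \<theta>) (carrier (Q_obj G))"
    by (rule inj_onI) (auto simp: dom.carrier_Q_obj Q_hom_zcoset cod.zcoset_eq_iff
        dom.zcoset_eq_iff closed frac_part dom.frac_part_closed inj_on_eq_iff[OF inj])
  moreover have "corder (Q_obj G) X Y W
      = corder (Q_obj H) (Q_hom G H \<theta> X) (Q_hom G H \<theta> Y) (Q_hom G H \<theta> W)"
    if "X \<in> carrier (Q_obj G)" "Y \<in> carrier (Q_obj G)" "W \<in> carrier (Q_obj G)" for X Y W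
    using that by (auto simp: dom.carrier_Q_obj Q_hom_zcoset dom.corder_Q_obj cod.corder_Q_obj
        closed frac_part dom.frac_part_closed cyclic_of_image)
  ultimately show ?thesis
    by (simp add: circ_hom_def) (simp add: Q_hom_def)
qed

end

lemma lo_morphismI:
  "G \<in> Obj LO_star \<Longrightarrow> H \<in> Obj LO_star \<Longrightarrow> \<theta> \<in> lo_hom G H \<Longrightarrow> lo_morphism G H \<theta>"
  by (simp add: lo_morphism_def lo_morphism_axioms_def quotient_objI)

section \<open>The categories and functors\<close>

lemma is_category_LO_star: "is_category (LO_star :: ('a lo_group, 'a \<Rightarrow> 'a) cat)"
proof -
  have id: "(\<lambda>x\<in>carrier G. x) \<in> lo_hom G G" if "G \<in> Obj LO_star" for G :: "'a lo_group"
    using that by (auto simp: lo_hom_def LO_star_def hom_def monoid.m_closed[OF group.is_monoid])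
  have comp: "compose (carrier G) \<psi> \<phi> \<in> lo_hom G K"
    if "\<phi> \<in> lo_hom G H" "\<psi> \<in> lo_hom H K" "G \<in> Obj LO_star" for G H K :: "'a lo_group" and \<phi> \<psi>
  proof -
    have "\<phi> x \<in> carrier H" if "x \<in> carrier G" for x
      using \<open>\<phi> \<in> lo_hom G H\<close> that by (auto simp: lo_hom_def hom_def)
    moreover have "x \<otimes>\<^bsub>G\<^esub> y \<in> carrier G" if "x \<in> carrier G" "y \<in> carrier G" for x y
      using \<open>G \<in> Obj LO_star\<close> that by (auto simp: LO_star_def group_def monoid.m_closed)
    ultimately show ?thesis
      using that by (auto simp: lo_hom_def LO_star_def hom_def compose_eq Pi_iff)
  qed
  have right: "compose (carrier G) \<phi> (\<lambda>x\<in>carrier G. x) = \<phi>"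
    and left: "compose (carrier G) (\<lambda>x\<in>carrier H. x) \<phi> = \<phi>"
    if "\<phi> \<in> lo_hom G H" for G H :: "'a lo_group" and \<phi>
    using that by (auto simp: lo_hom_def hom_def compose_Id Id_compose)
  have assoc: "compose (carrier G) \<chi> (compose (carrier G) \<psi> \<phi>)
      = compose (carrier G) (compose (carrier H) \<chi> \<psi>) \<phi>"
    if "\<phi> \<in> lo_hom G H" for G H :: "'a lo_group" and \<phi> \<psi> \<chi>
    using that by (intro compose_assoc) (auto simp: lo_hom_def hom_def)
  show ?thesis
    unfolding is_category_def
    using id comp right left assoc by (auto simp: LO_star_def)
qed

lemma is_category_Circ: "is_category (Circ :: ('a circ_group, 'a \<Rightarrow> 'a) cat)"
proof -
  have id: "(\<lambda>x\<in>carrier G. x) \<in> circ_hom G G" if "G \<in> Obj Circ" for G :: "'a circ_group"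
    using that by (auto simp: circ_hom_def Circ_def hom_def inj_on_def
        monoid.m_closed[OF group.is_monoid])
  have comp: "compose (carrier G) \<psi> \<phi> \<in> circ_hom G K"
    if "\<phi> \<in> circ_hom G H" "\<psi> \<in> circ_hom H K" "G \<in> Obj Circ" for G H K :: "'a circ_group" and \<phi> \<psi>
  proof -
    have "\<phi> x \<in> carrier H" if "x \<in> carrier G" for x
      using \<open>\<phi> \<in> circ_hom G H\<close> that by (auto simp: circ_hom_def hom_def)
    moreover have "x \<otimes>\<^bsub>G\<^esub> y \<in> carrier G" if "x \<in> carrier G" "y \<in> carrier G" for x y
      using \<open>G \<in> Obj Circ\<close> that by (auto simp: Circ_def group_def monoid.m_closed)
    ultimately show ?thesis
      using that by (auto simp: circ_hom_def Circ_def hom_def compose_eq Pi_iff inj_on_def)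
  qed
  have right: "compose (carrier G) \<phi> (\<lambda>x\<in>carrier G. x) = \<phi>"
    and left: "compose (carrier G) (\<lambda>x\<in>carrier H. x) \<phi> = \<phi>"
    if "\<phi> \<in> circ_hom G H" for G H :: "'a circ_group" and \<phi>
    using that by (auto simp: circ_hom_def hom_def compose_Id Id_compose)
  have assoc: "compose (carrier G) \<chi> (compose (carrier G) \<psi> \<phi>)
      = compose (carrier G) (compose (carrier H) \<chi> \<psi>) \<phi>"
    if "\<phi> \<in> circ_hom G H" for G H :: "'a circ_group" and \<phi> \<psi> \<chi>
    using that by (intro compose_assoc) (auto simp: circ_hom_def hom_def)
  show ?thesis
    unfolding is_category_def
    using id comp right left assoc by (auto simp: Circ_def)
qed

text \<open>Unfolding the categories themselves would also expose the description of their objects; these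
  equations leave it folded.\<close>

lemma Hom_Ident_Comp:
  "Hom LO_star = lo_hom" "Ident LO_star = (\<lambda>G. \<lambda>x\<in>carrier G. x)"
  "Comp LO_star = (\<lambda>G H K \<psi> \<phi>. compose (carrier G) \<psi> \<phi>)"
  "Hom Circ = circ_hom" "Ident Circ = (\<lambda>G. \<lambda>x\<in>carrier G. x)"
  "Comp Circ = (\<lambda>G H K \<psi> \<phi>. compose (carrier G) \<psi> \<phi>)"
  by (simp_all add: LO_star_def Circ_def)

lemma is_functor_Q_functor: "is_functor LO_star Circ Q_functor"
proof -
  have id: "Q_hom G G (\<lambda>x\<in>carrier G. x) = (\<lambda>x\<in>carrier (Q_obj G). x)"
    if "G \<in> Obj LO_star" for G :: "'a universe lo_group"
  proof -
    have "(\<lambda>x\<in>carrier G. x) \<in> lo_hom G G"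
      using is_category_LO_star that by (auto simp: is_category_def Hom_Ident_Comp)
    then interpret lo_morphism G G "\<lambda>x\<in>carrier G. x"
      using that by (intro lo_morphismI)
    show ?thesis
      by (rule extensionalityI[of _ "carrier (Q_obj G)"])
        (auto simp: dom.carrier_Q_obj Q_hom_zcoset, auto simp: Q_hom_def dom.carrier_Q_obj)
  qed
  have comp: "Q_hom G K (compose (carrier G) \<psi> \<phi>)
      = compose (carrier (Q_obj G)) (Q_hom H K \<psi>) (Q_hom G H \<phi>)"
    if obj: "G \<in> Obj LO_star" "H \<in> Obj LO_star" "K \<in> Obj LO_star"
      and m: "\<phi> \<in> lo_hom G H" "\<psi> \<in> lo_hom H K"
    for G H K :: "'a universe lo_group" and \<psi> \<phi>
  proof -
    interpret \<phi>: lo_morphism G H \<phi> using obj m by (intro lo_morphismI)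
    interpret \<psi>: lo_morphism H K \<psi> using obj m by (intro lo_morphismI)
    have "compose (carrier G) \<psi> \<phi> \<in> lo_hom G K"
      using is_category_LO_star obj m
      unfolding is_category_def Hom_Ident_Comp by blast
    then interpret \<psi>\<phi>: lo_morphism G K "compose (carrier G) \<psi> \<phi>"
      using obj by (intro lo_morphismI)
    show ?thesis
    proof (rule extensionalityI[of _ "carrier (Q_obj G)"])
      fix X assume X: "X \<in> carrier (Q_obj G)"
      then obtain x where x: "X = zcoset G x" "x \<in> carrier G"
        by (auto simp: \<phi>.dom.carrier_Q_obj)
      show "Q_hom G K (compose (carrier G) \<psi> \<phi>) X
          = compose (carrier (Q_obj G)) (Q_hom H K \<psi>) (Q_hom G H \<phi>) X"
        using X x by (simp add: compose_eq \<psi>\<phi>.Q_hom_zcoset \<phi>.Q_hom_zcoset \<psi>.Q_hom_zcoset \<phi>.closed)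
    qed (auto simp: Q_hom_def)
  qed
  show ?thesis
    using quotient_obj.Q_obj_in_Circ[OF quotient_objI]
      lo_morphism.Q_hom_in_circ_hom[OF lo_morphismI]
    unfolding is_functor_def Hom_Ident_Comp
    by (auto simp: Q_functor_def id comp)
qed

section \<open>The two natural isomorphisms\<close>

lemma restricted_inverse:
  assumes "group G" and f: "f \<in> hom G H" "f \<in> extensional (carrier G)"
    and bij: "inj_on f (carrier G)" "f ` carrier G = carrier H"
  defines "g \<equiv> (\<lambda>y\<in>carrier H. inv_into (carrier G) f y)"
  shows "g \<in> hom H G" "g \<in> extensional (carrier H)"
    "compose (carrier G) g f = (\<lambda>x\<in>carrier G. x)"
    "compose (carrier H) f g = (\<lambda>y\<in>carrier H. y)"
    "\<And>y. y \<in> carrier H \<Longrightarrow> g y \<in> carrier G \<and> f (g y) = y"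
proof -
  interpret group G by fact
  have gf: "g (f x) = x" if "x \<in> carrier G" for x
    using that bij by (auto simp: g_def)
  show fg: "g y \<in> carrier G \<and> f (g y) = y" if "y \<in> carrier H" for y
    using that bij by (auto simp: g_def inv_into_into f_inv_into_f)
  show "g \<in> hom H G"
  proof (rule homI)
    fix y w assume "y \<in> carrier H" "w \<in> carrier H"
    then have "y \<otimes>\<^bsub>H\<^esub> w = f (g y \<otimes>\<^bsub>G\<^esub> g w)" "g y \<otimes>\<^bsub>G\<^esub> g w \<in> carrier G"
      using fg hom_mult[OF f(1)] by auto
    then show "g (y \<otimes>\<^bsub>H\<^esub> w) = g y \<otimes>\<^bsub>G\<^esub> g w"
      by (simp add: gf)
  qed (use fg in blast)
  show "g \<in> extensional (carrier H)" by (simp add: g_def)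
  show "compose (carrier G) g f = (\<lambda>x\<in>carrier G. x)"
    "compose (carrier H) f g = (\<lambda>y\<in>carrier H. y)"
    using gf fg by (auto simp: compose_def restrict_def)
qed

text \<open>Order preservation makes a morphism injective and its inverse a morphism, because the orders are
  total and irreflexive.\<close>

lemma lo_isomorphismI:
  assumes G: "G \<in> Obj LO_star" and H: "H \<in> Obj LO_star"
    and f: "f \<in> lo_hom G H" and surj: "f ` carrier G = carrier H"
  shows "is_isomorphism LO_star G H f"
proof -
  have "group G" using G by (simp add: LO_star_def)
  have lin: "strict_linear_on (carrier G) (lless G)" "strict_linear_on (carrier H) (lless H)"
    and z: "zelt G \<in> carrier G"
    using G H by (auto simp: LO_star_def left_ordering_def strict_linear_on_def)
  have h: "f \<in> hom G H" "f \<in> extensional (carrier G)"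
    and less: "\<And>x y. x \<in> carrier G \<Longrightarrow> y \<in> carrier G \<Longrightarrow> lless G x y \<longleftrightarrow> lless H (f x) (f y)"
    and fz: "f (zelt G) = zelt H"
    using f by (auto simp: lo_hom_def)
  have inj: "inj_on f (carrier G)"
    using less strict_linear_onD(3)[OF lin(1)] strict_linear_onD(1)[OF lin(2)] surj
    by (metis inj_onI imageI)
  define g where "g = (\<lambda>y\<in>carrier H. inv_into (carrier G) f y)"
  note inv = restricted_inverse[OF \<open>group G\<close> h inj surj, folded g_def]
  have "g (zelt H) = zelt G"
    using inv(3) z unfolding fz[symmetric] by (metis compose_eq restrict_apply')
  moreover have "lless H x y \<longleftrightarrow> lless G (g x) (g y)" if "x \<in> carrier H" "y \<in> carrier H" for x y
    using inv(5) less that by metis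
  ultimately have "g \<in> lo_hom H G"
    using inv(1,2) by (simp add: lo_hom_def)
  with f inv(3,4) show ?thesis
    unfolding is_isomorphism_def Hom_Ident_Comp by blast
qed

lemma circ_isomorphismI:
  assumes G: "G \<in> Obj Circ" and f: "f \<in> circ_hom G H" and surj: "f ` carrier G = carrier H"
  shows "is_isomorphism Circ G H f"
proof -
  have "group G" using G by (simp add: Circ_def)
  have h: "f \<in> hom G H" "f \<in> extensional (carrier G)" and inj: "inj_on f (carrier G)"
    and c: "\<And>x y w. x \<in> carrier G \<Longrightarrow> y \<in> carrier G \<Longrightarrow> w \<in> carrier G \<Longrightarrow>
      corder G x y w = corder H (f x) (f y) (f w)"
    using f by (auto simp: circ_hom_def)
  define g where "g = (\<lambda>y\<in>carrier H. inv_into (carrier G) f y)"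
  note inv = restricted_inverse[OF \<open>group G\<close> h inj surj, folded g_def]
  have "corder H x y w = corder G (g x) (g y) (g w)"
    if "x \<in> carrier H" "y \<in> carrier H" "w \<in> carrier H" for x y w
    using c[of "g x" "g y" "g w"] inv(5) that by simp
  moreover have "inj_on g (carrier H)"
    using inv(5) by (metis inj_onI)
  ultimately have "g \<in> circ_hom H G"
    using inv(1,2) by (simp add: circ_hom_def)
  with f inv(3,4) show ?thesis
    unfolding is_isomorphism_def Hom_Ident_Comp by blast
qed

definition LQ_iso :: "'a universe lo_group \<Rightarrow> 'a universe \<Rightarrow> 'a universe" where
  "LQ_iso G = (\<lambda>x\<in>carrier (L_obj (Q_obj G)).
     min_rep G (decode_set (lift_elt x)) \<otimes>\<^bsub>G\<^esub> zelt G [^]\<^bsub>G\<^esub> lift_int x)"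

definition QL_iso :: "'a universe circ_group \<Rightarrow> 'a universe \<Rightarrow> 'a universe" where
  "QL_iso G = (\<lambda>X\<in>carrier (Q_obj (L_obj G)). lift_elt (min_rep (L_obj G) (decode_set X)))"

context quotient_obj
begin

lemma carrier_LQ: "carrier (L_obj (Q_obj G)) = {Lift n (zcoset G r) | n r. r \<in> fundamental}"
proof -
  interpret Q: lift_obj "Q_obj G" by (rule lift_objI[OF Q_obj_in_Circ])
  have "\<exists>r\<in>fundamental. zcoset G x = zcoset G r" if "x \<in> carrier G" for x
    using that zcoset_frac_part frac_part_fundamental by metis
  then show ?thesis
    using fundamental_closed by (fastforce simp: Q.carrier_L_obj carrier_Q_obj)
qed

lemma LQ_iso_Lift:
  assumes "r \<in> fundamental"
  shows "LQ_iso G (Lift n (zcoset G r)) = r \<otimes> zpow n"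
proof -
  have "Lift n (zcoset G r) \<in> carrier (L_obj (Q_obj G))"
    using assms carrier_LQ by blast
  then show ?thesis
    using assms fundamental_closed[OF assms]
    by (simp add: LQ_iso_def decode_zcoset min_rep_coset frac_part_of_fundamental)
qed

text \<open>Multiplying \<open>r z\<^sup>m\<close> and \<open>s z\<^sup>n\<close> collects the central factors, and rewriting \<open>r s\<close> by its fractional
  part produces the carry, which is the cocycle that the product in the lift adds.\<close>

lemma LQ_iso_mult:
  assumes r: "r \<in> fundamental" and s: "s \<in> fundamental"
  shows "LQ_iso G (Lift m (zcoset G r) \<otimes>\<^bsub>L_obj (Q_obj G)\<^esub> Lift n (zcoset G s))
    = (r \<otimes> zpow m) \<otimes> (s \<otimes> zpow n)"
proof -
  interpret Q: lift_obj "Q_obj G" by (rule lift_objI[OF Q_obj_in_Circ])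
  have c: "r \<in> carrier G" "s \<in> carrier G" using r s fundamental_closed by auto
  define t k where "t = frac_part (r \<otimes> s)" and "k = int_part (r \<otimes> s)"
  have t: "t \<in> fundamental" "t \<otimes> zpow k = r \<otimes> s" "zcoset G (r \<otimes> s) = zcoset G t"
    using c by (simp_all add: t_def k_def frac_part_fundamental decomp zcoset_frac_part)
  have "LQ_iso G (Lift m (zcoset G r) \<otimes>\<^bsub>L_obj (Q_obj G)\<^esub> Lift n (zcoset G s))
      = t \<otimes> zpow (k + (m + n))"
    using r s c t by (simp add: Q.mult_L_obj mult_Q_obj lift_cocycle_Q_obj k_def[symmetric]
        LQ_iso_Lift add_ac)
  also have "\<dots> = (r \<otimes> s) \<otimes> zpow (m + n)"
    using t fundamental_closed[OF t(1)] by (simp add: mult_zpow_zpow[symmetric])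
  also have "\<dots> = r \<otimes> (s \<otimes> zpow m) \<otimes> zpow n"
    using c by (simp add: mult_zpow_zpow[symmetric] m_assoc)
  also have "\<dots> = (r \<otimes> zpow m) \<otimes> (s \<otimes> zpow n)"
    using c by (simp add: zpow_commute[of s m, symmetric] m_assoc)
  finally show ?thesis .
qed

lemma LQ_iso_isomorphism: "is_isomorphism LO_star (L_obj (Q_obj G)) G (LQ_iso G)"
proof (rule lo_isomorphismI)
  interpret Q: lift_obj "Q_obj G" by (rule lift_objI[OF Q_obj_in_Circ])
  show "L_obj (Q_obj G) \<in> Obj LO_star" by (rule Q.L_obj_in_LO_star)
  show "G \<in> Obj LO_star"
    using group_axioms left_ordered z_central z_positive z_cofinal by (simp add: LO_star_def)
  have "LQ_iso G \<in> hom (L_obj (Q_obj G)) G"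
    by (rule homI) (auto simp: carrier_LQ LQ_iso_Lift LQ_iso_mult fundamental_closed)
  moreover have "lless (L_obj (Q_obj G)) x y \<longleftrightarrow> LQ_iso G x \<prec> LQ_iso G y"
    if "x \<in> carrier (L_obj (Q_obj G))" "y \<in> carrier (L_obj (Q_obj G))" for x y
    using that by (auto simp: carrier_LQ LQ_iso_Lift fundamental_less_iff Q.lless_L_obj
        zcoset_closed fundamental_closed cut_Q_obj frac_part_of_fundamental)
  moreover have "LQ_iso G (zelt (L_obj (Q_obj G))) = zelt G"
    by (simp add: Q.zelt_L_obj one_Q_obj LQ_iso_Lift one_fundamental)
  ultimately show "LQ_iso G \<in> lo_hom (L_obj (Q_obj G)) G"
    by (simp add: lo_hom_def) (simp add: LQ_iso_def)
  show "LQ_iso G ` carrier (L_obj (Q_obj G)) = carrier G"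
  proof
    show "carrier G \<subseteq> LQ_iso G ` carrier (L_obj (Q_obj G))"
    proof
      fix x assume "x \<in> carrier G"
      then obtain k r where "r \<in> fundamental" "x = r \<otimes> zpow k"
        using ex_fundamental_decomp by blast
      then show "x \<in> LQ_iso G ` carrier (L_obj (Q_obj G))"
        using LQ_iso_Lift carrier_LQ by (intro image_eqI[of _ _ "Lift k (zcoset G r)"]) auto
    qed
  qed (auto simp: carrier_LQ LQ_iso_Lift fundamental_closed)
qed

end

lemma (in lo_morphism) LQ_iso_natural:
  "compose (carrier (L_obj (Q_obj G))) (LQ_iso H) (L_hom (Q_obj G) (Q_obj H) (Q_hom G H \<theta>))
    = compose (carrier (L_obj (Q_obj G))) \<theta> (LQ_iso G)"
proof (rule extensionalityI[of _ "carrier (L_obj (Q_obj G))"])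
  fix x assume x: "x \<in> carrier (L_obj (Q_obj G))"
  then obtain n r where r: "x = Lift n (zcoset G r)" "r \<in> dom.fundamental"
    by (auto simp: dom.carrier_LQ)
  then have "r \<in> carrier G" by (simp add: dom.fundamental_closed)
  then show "compose (carrier (L_obj (Q_obj G))) (LQ_iso H)
      (L_hom (Q_obj G) (Q_obj H) (Q_hom G H \<theta>)) x
    = compose (carrier (L_obj (Q_obj G))) \<theta> (LQ_iso G) x"
    using x r by (simp add: compose_eq L_hom_Lift dom.zcoset_closed Q_hom_zcoset
        cod.LQ_iso_Lift dom.LQ_iso_Lift fundamental mult zpow)
qed auto

lemma naturally_isomorphic_LQ:
  "naturally_isomorphic LO_star LO_star (comp_functor L_functor Q_functor) id_functor"
proof -
  have "is_isomorphism LO_star (L_obj (Q_obj G)) G (LQ_iso G)"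
    if "G \<in> Obj LO_star" for G :: "'a universe lo_group"
    using that by (rule quotient_obj.LQ_iso_isomorphism[OF quotient_objI])
  then show ?thesis
    using lo_morphism.LQ_iso_natural[OF lo_morphismI]
    unfolding naturally_isomorphic_def natural_transformation_def
    by (intro exI[of _ LQ_iso])
      (auto simp: comp_functor_def id_functor_def L_functor_def Q_functor_def is_isomorphism_def
        Hom_Ident_Comp)
qed

context lift_obj
begin

sublocale lift: quotient_obj "L_obj G"
  by (rule quotient_objI[OF L_obj_in_LO_star])

lemma lift_fundamental: "lift.fundamental = {Lift 0 a | a. a \<in> carrier G}"
proof -
  have "cut \<one> \<one> a \<longleftrightarrow> \<one> \<noteq> a" "\<not> cut \<one> a \<one>" for a
    by (auto simp: cut_def)
  then show ?thesis
    by (auto simp: lift.fundamental_def carrier_L_obj one_L_obj zelt_L_obj lless_L_obj)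
qed

text \<open>In the lift \<open>(n, a) = (0, a) z\<^sup>n\<close>, so the two coordinates are the integer and the fractional part.\<close>

lemma frac_part_Lift:
  assumes "a \<in> carrier G"
  shows "lift.frac_part (Lift n a) = Lift 0 a"
proof -
  have "Lift n a = Lift 0 a \<otimes>\<^bsub>L_obj G\<^esub> lift.zpow n"
    using assms by (simp add: int_pow_zelt_L_obj mult_L_obj lift_cocycle_one)
  then show ?thesis
    using assms by (metis (mono_tags, lifting) lift.frac_part_decomp lift_fundamental mem_Collect_eq)
qed

lemma carrier_QL: "carrier (Q_obj (L_obj G)) = {zcoset (L_obj G) (Lift n a) | n a. a \<in> carrier G}"
  by (auto simp: lift.carrier_Q_obj carrier_L_obj)

lemma QL_iso_zcoset:
  assumes "a \<in> carrier G"
  shows "QL_iso G (zcoset (L_obj G) (Lift n a)) = a"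
  using assms lift.zcoset_closed[of "Lift n a"]
  by (simp add: QL_iso_def lift.decode_zcoset lift.min_rep_coset Lift_mem frac_part_Lift)

text \<open>On the fundamental domain of the lift the lexicographic order is \<open>cut id\<close>, from which the original
  circular order is recovered.\<close>

lemma cyclic_of_Lift:
  "a \<in> carrier G \<Longrightarrow> b \<in> carrier G \<Longrightarrow> d \<in> carrier G \<Longrightarrow>
    cyclic_of (lless (L_obj G)) (Lift 0 a) (Lift 0 b) (Lift 0 d) = corder G a b d"
  by (simp add: corder_eq_cyclic_of_cut[OF one_closed]) (simp add: cyclic_of_def lless_L_obj)

lemma QL_iso_isomorphism: "is_isomorphism Circ (Q_obj (L_obj G)) G (QL_iso G)"
proof (rule circ_isomorphismI)
  show "Q_obj (L_obj G) \<in> Obj Circ" by (rule lift.Q_obj_in_Circ)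
  have "QL_iso G \<in> hom (Q_obj (L_obj G)) G"
    by (rule homI) (auto simp: carrier_QL QL_iso_zcoset lift.mult_Q_obj Lift_mem mult_L_obj)
  moreover have "inj_on (QL_iso G) (carrier (Q_obj (L_obj G)))"
    by (rule inj_onI) (auto simp: carrier_QL QL_iso_zcoset lift.zcoset_eq_iff Lift_mem frac_part_Lift)
  moreover have "corder (Q_obj (L_obj G)) X Y W = corder G (QL_iso G X) (QL_iso G Y) (QL_iso G W)"
    if "X \<in> carrier (Q_obj (L_obj G))" "Y \<in> carrier (Q_obj (L_obj G))"
      "W \<in> carrier (Q_obj (L_obj G))" for X Y W
    using that by (auto simp: carrier_QL QL_iso_zcoset lift.corder_Q_obj Lift_mem frac_part_Lift
        cyclic_of_Lift)
  ultimately show "QL_iso G \<in> circ_hom (Q_obj (L_obj G)) G"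
    by (simp add: circ_hom_def) (simp add: QL_iso_def)
  show "QL_iso G ` carrier (Q_obj (L_obj G)) = carrier G"
    by (auto simp: carrier_QL QL_iso_zcoset image_iff) (metis QL_iso_zcoset)
qed

end

lemma QL_iso_natural:
  assumes G: "G \<in> Obj Circ" and H: "H \<in> Obj Circ" and \<phi>: "\<phi> \<in> circ_hom G H"
  shows "compose (carrier (Q_obj (L_obj G))) (QL_iso H) (Q_hom (L_obj G) (L_obj H) (L_hom G H \<phi>))
    = compose (carrier (Q_obj (L_obj G))) \<phi> (QL_iso G)"
proof -
  interpret G: lift_obj G by (rule lift_objI[OF G])
  interpret H: lift_obj H by (rule lift_objI[OF H])
  interpret lo_morphism "L_obj G" "L_obj H" "L_hom G H \<phi>"
    by (intro lo_morphismI G.L_obj_in_LO_star H.L_obj_in_LO_star L_hom_in_lo_hom assms)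
  show ?thesis
  proof (rule extensionalityI[of _ "carrier (Q_obj (L_obj G))"])
    fix X assume X: "X \<in> carrier (Q_obj (L_obj G))"
    then obtain n a where a: "X = zcoset (L_obj G) (Lift n a)" "a \<in> carrier G"
      by (auto simp: G.carrier_QL)
    then have "\<phi> a \<in> carrier H" using \<phi> by (auto simp: circ_hom_def hom_def)
    then show "compose (carrier (Q_obj (L_obj G))) (QL_iso H)
        (Q_hom (L_obj G) (L_obj H) (L_hom G H \<phi>)) X
      = compose (carrier (Q_obj (L_obj G))) \<phi> (QL_iso G) X"
      using X a by (simp add: compose_eq Q_hom_zcoset G.Lift_mem L_hom_Lift
          H.QL_iso_zcoset G.QL_iso_zcoset)
  qed auto
qed

lemma naturally_isomorphic_QL:
  "naturally_isomorphic Circ Circ (comp_functor Q_functor L_functor) id_functor"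
proof -
  have "is_isomorphism Circ (Q_obj (L_obj G)) G (QL_iso G)"
    if "G \<in> Obj Circ" for G :: "'a universe circ_group"
    using that by (rule lift_obj.QL_iso_isomorphism[OF lift_objI])
  then show ?thesis
    using QL_iso_natural
    unfolding naturally_isomorphic_def natural_transformation_def
    by (intro exI[of _ QL_iso])
      (auto simp: comp_functor_def id_functor_def L_functor_def Q_functor_def is_isomorphism_def
        Hom_Ident_Comp)
qed

theorem proposition2p9:
  shows "equivalence_of_categories
           (LO_star :: ('a universe lo_group, 'a universe \<Rightarrow> 'a universe) cat)
           (Circ :: ('a universe circ_group, 'a universe \<Rightarrow> 'a universe) cat)
           Q_functor L_functor"
  unfolding equivalence_of_categories_def
  using is_category_LO_star is_category_Circ is_functor_Q_functor is_functor_L_functor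
    naturally_isomorphic_LQ naturally_isomorphic_QL
  by blast

end
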